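(* Let $\mathcal{N}$ be a nest of a complex Hilbert space $\mathbf{H}$ with $\dim\mathbf{H}\geq 3$, and let $\mathcal{T}=\mathcal{T}(\mathcal{N})$ be the associated nest algebra. Then each Lie biderivation $\varphi$ of $\mathcal{T}$ is the sum of an extremal biderivation, an inner biderivation and a central mapping; that is, there exist $a\in\mathcal{T}$, $\lambda\in\mathcal{Z}(\mathcal{T})$ and a central mapping $\mu:\mathcal{T}\times\mathcal{T}\to\mathcal{Z}(\mathcal{T})$ such that $\varphi(x,y)=[x,[y,a]]+\lambda[x,y]+\mu(x,y)$ for all $x,y\in\mathcal{T}$.
   Context: A nest $\mathcal{N}$ of $\mathbf{H}$ is a set of closed subspaces of $\mathbf{H}$ that contains $0$ and $\mathbf{H}$, is totally ordered by inclusion, and is closed under arbitrary intersections and under norm closures of linear spans of arbitrary unions. The nest algebra is $\mathcal{T}(\mathcal{N})=\{T\in\mathcal{B}(\mathbf{H}) : T(N)\subseteq N \text{ for all } N\in\mathcal{N}\}$, where $\mathcal{B}(\mathbf{H})$ is the algebra of bounded linear operators on $\mathbf{H}$; it is viewed as a complex algebra. $[x,y]=xy-yx$ and $\mathcal{Z}(\cdot)$ is the center. A Lie biderivation of an algebra $\mathcal{A}$ is a bilinear map $\varphi:\mathcal{A}\times\mathcal{A}\to\mathcal{A}$ with $\varphi([x,z],y)=[\varphi(x,y),z]+[x,\varphi(z,y)]$ and $\varphi(x,[y,z])=[\varphi(x,y),z]+[y,\varphi(x,z)]$ for all $x,y,z$. An inner biderivation is a map $(x,y)\mapsto\lambda[x,y]$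 with $\lambda\in\mathcal{Z}(\mathcal{A})$. An extremal biderivation is a bilinear map of the form $(x,y)\mapsto[x,[y,a]]$ with $a\in\mathcal{A}$ (the zero map, $a$ central, is allowed as a degenerate case). A central mapping is a map with values in the center. *)

theory Defs
  imports "HOL-Analysis.Analysis"
begin

section \<open>Complex vector spaces, algebras and Hilbert spaces\<close>

class complex_vector = ab_group_add +
  fixes scaleC :: "complex \<Rightarrow> 'a \<Rightarrow> 'a" (infixr "*\<^sub>C" 75)
  assumes scaleC_add_right: "c *\<^sub>C (x + y) = c *\<^sub>C x + c *\<^sub>C y"
    and scaleC_add_left: "(c + d) *\<^sub>C x = c *\<^sub>C x + d *\<^sub>C x"
    and scaleC_scaleC: "c *\<^sub>C (d *\<^sub>C x) = (c * d) *\<^sub>C x"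
    and scaleC_one: "1 *\<^sub>C x = x"

global_interpretation complex_vector:
  vector_space "scaleC :: complex \<Rightarrow> 'a \<Rightarrow> 'a::complex_vector"
  by unfold_locales
    (simp_all add: scaleC_add_right scaleC_add_left scaleC_scaleC scaleC_one)

text \<open>No unit is required: the operators on the zero space form an algebra with \<open>0 = 1\<close>,
  which the class \<open>ring_1\<close> excludes.\<close>

class complex_algebra = complex_vector + ring +
  assumes mult_scaleC_left: "(c *\<^sub>C x) * y = c *\<^sub>C (x * y)"
    and mult_scaleC_right: "x * (c *\<^sub>C y) = c *\<^sub>C (x * y)"

text \<open>The inner product is linear in its first argument. Completeness, and the topology used by
  \<open>closed\<close> and \<open>closure\<close>, come from \<open>banach\<close>; its norm is required to be the one induced by the
  inner product, and its real scaling the restriction of the complex one.\<close>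

class complex_hilbert_space = complex_vector + banach +
  fixes cinner :: "'a \<Rightarrow> 'a \<Rightarrow> complex"
  assumes scaleR_scaleC: "r *\<^sub>R x = complex_of_real r *\<^sub>C x"
    and cinner_commute: "cinner x y = cnj (cinner y x)"
    and cinner_add_left: "cinner (x + y) z = cinner x z + cinner y z"
    and cinner_scaleC_left: "cinner (c *\<^sub>C x) y = c * cinner x y"
    and cinner_ge_zero: "0 \<le> Re (cinner x x)"
    and cinner_eq_zero_iff: "cinner x x = 0 \<longleftrightarrow> x = 0"
    and norm_eq_sqrt_cinner: "norm x = sqrt (Re (cinner x x))"

text \<open>The library's \<open>dim\<close> is \<open>0\<close> on infinite-dimensional spaces, so it is only consulted when a
  finite spanning set exists.\<close>

definition complex_dim_ge :: "'a::complex_vector itself \<Rightarrow> nat \<Rightarrow> bool" where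
  "complex_dim_ge _ n \<longleftrightarrow>
     ((\<exists>B::'a set. finite B \<and> complex_vector.span B = UNIV) \<longrightarrow>
        n \<le> complex_vector.dim (UNIV :: 'a set))"


section \<open>Bounded linear operators\<close>

text \<open>\<open>bounded_linear\<close> only asks for real linearity.\<close>

typedef (overloaded) 'a bounded_op =
  "{T :: 'a::complex_hilbert_space \<Rightarrow> 'a. bounded_linear T \<and> (\<forall>c x. T (c *\<^sub>C x) = c *\<^sub>C T x)}"
  morphisms op_apply Bounded_Op
  by (rule exI[of _ "\<lambda>x. 0"]) simp

setup_lifting type_definition_bounded_op

lemma bounded_linear_scaleC:
  "bounded_linear (\<lambda>x::'a::complex_hilbert_space. c *\<^sub>C x)"
proof (rule bounded_linear_intro)
  fix x :: 'a
  have "cinner (c *\<^sub>C x) (c *\<^sub>C x) = c * cnj c * cinner x x"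
    by (metis cinner_commute cinner_scaleC_left complex_cnj_mult mult.assoc)
  then have "Re (cinner (c *\<^sub>C x) (c *\<^sub>C x)) = (cmod c)\<^sup>2 * Re (cinner x x)"
    by (simp add: complex_mult_cnj cmod_power2)
  then show "norm (c *\<^sub>C x) \<le> norm x * cmod c"
    by (simp add: norm_eq_sqrt_cinner real_sqrt_mult)
qed (simp_all add: scaleC_add_right scaleR_scaleC scaleC_scaleC mult.commute)

instantiation bounded_op :: (complex_hilbert_space) complex_algebra
begin

lift_definition zero_bounded_op :: "'a bounded_op" is "\<lambda>x. 0"
  by simp

lift_definition plus_bounded_op :: "'a bounded_op \<Rightarrow> 'a bounded_op \<Rightarrow> 'a bounded_op"
  is "\<lambda>S T x. S x + T x"
  by (simp add: bounded_linear_add scaleC_add_right)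

lift_definition uminus_bounded_op :: "'a bounded_op \<Rightarrow> 'a bounded_op"
  is "\<lambda>T x. - T x"
  by (simp add: bounded_linear_minus)

lift_definition minus_bounded_op :: "'a bounded_op \<Rightarrow> 'a bounded_op \<Rightarrow> 'a bounded_op"
  is "\<lambda>S T x. S x - T x"
  by (simp add: bounded_linear_sub complex_vector.scale_right_diff_distrib)

lift_definition times_bounded_op :: "'a bounded_op \<Rightarrow> 'a bounded_op \<Rightarrow> 'a bounded_op"
  is "\<lambda>S T x. S (T x)"
  by (simp add: bounded_linear_compose)

lift_definition scaleC_bounded_op :: "complex \<Rightarrow> 'a bounded_op \<Rightarrow> 'a bounded_op"
  is "\<lambda>c T x. c *\<^sub>C T x"
  by (auto intro: bounded_linear_compose[OF bounded_linear_scaleC]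
      simp: scaleC_scaleC mult.commute)

instance
  by standard
    (transfer; force simp: scaleC_add_right scaleC_add_left scaleC_scaleC scaleC_one
      linear_simps algebra_simps)+

end


section \<open>Nests and nest algebras\<close>

definition nest :: "'a::complex_hilbert_space set set \<Rightarrow> bool" where
  "nest \<N> \<longleftrightarrow>
     (\<forall>N\<in>\<N>. complex_vector.subspace N \<and> closed N) \<and>
     {0} \<in> \<N> \<and> UNIV \<in> \<N> \<and>
     (\<forall>M\<in>\<N>. \<forall>N\<in>\<N>. M \<subseteq> N \<or> N \<subseteq> M) \<and>
     (\<forall>\<F>\<subseteq>\<N>. \<Inter>\<F> \<in> \<N> \<and> closure (complex_vector.span (\<Union>\<F>)) \<in> \<N>)"

definition nest_algebra :: "'a::complex_hilbert_space set set \<Rightarrow> 'a bounded_op set" where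
  "nest_algebra \<N> = {T. \<forall>N\<in>\<N>. op_apply T ` N \<subseteq> N}"


section \<open>Lie biderivations\<close>

text \<open>The following notions concern a subalgebra \<open>A\<close>, given by its carrier; only the values of
  \<open>\<phi>\<close> at arguments in \<open>A\<close> matter.\<close>

definition commutator :: "'b::ring \<Rightarrow> 'b \<Rightarrow> 'b" where
  "commutator x y = x * y - y * x"

definition center :: "'b::ring set \<Rightarrow> 'b set" where
  "center A = {z\<in>A. \<forall>x\<in>A. z * x = x * z}"

definition bilinear_map_on :: "'b::complex_algebra set \<Rightarrow> ('b \<Rightarrow> 'b \<Rightarrow> 'b) \<Rightarrow> bool" where
  "bilinear_map_on A \<phi> \<longleftrightarrow>
     (\<forall>x\<in>A. \<forall>y\<in>A. \<phi> x y \<in> A) \<and>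
     (\<forall>x\<in>A. \<forall>x'\<in>A. \<forall>y\<in>A. \<phi> (x + x') y = \<phi> x y + \<phi> x' y) \<and>
     (\<forall>x\<in>A. \<forall>y\<in>A. \<forall>y'\<in>A. \<phi> x (y + y') = \<phi> x y + \<phi> x y') \<and>
     (\<forall>c. \<forall>x\<in>A. \<forall>y\<in>A. \<phi> (c *\<^sub>C x) y = c *\<^sub>C \<phi> x y \<and> \<phi> x (c *\<^sub>C y) = c *\<^sub>C \<phi> x y)"

definition Lie_biderivation :: "'b::complex_algebra set \<Rightarrow> ('b \<Rightarrow> 'b \<Rightarrow> 'b) \<Rightarrow> bool" where
  "Lie_biderivation A \<phi> \<longleftrightarrow>
     bilinear_map_on A \<phi> \<and>
     (\<forall>x\<in>A. \<forall>y\<in>A. \<forall>z\<in>A.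
        \<phi> (commutator x z) y = commutator (\<phi> x y) z + commutator x (\<phi> z y) \<and>
        \<phi> x (commutator y z) = commutator (\<phi> x y) z + commutator y (\<phi> x z))"

end

theory Submission
  imports Defs
begin

text \<open>Let \<open>p\<close> be the projection onto a closed subspace \<open>N\<close> that is proper, nonzero and comparable with
  all members of the nest: a member of the nest, or a line if the nest is trivial. It grades the
  nest algebra as \<open>T = T\<^sub>0 + T\<^sub>1 + T'\<close> with \<open>T\<^sub>0\<close> the commutant of \<open>p\<close>, \<open>T\<^sub>1\<close> the full corner
  \<open>p B(H) (1 - p)\<close>, and \<open>T'\<close> the opposite corner, which vanishes if \<open>N\<close> is in the nest. Using rank-one
  operators, a linear map of \<open>T\<^sub>1\<close> that commutes with all \<open>[b, _]\<close>, \<open>b \<in> T\<^sub>0\<close>, is a scalar.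

  The off-diagonal part \<open>a\<close> of \<open>\<phi>(p, p)\<close> satisfies \<open>[[T\<^sub>0, T\<^sub>0], a] = 0\<close>. Hence \<open>a = 0\<close> for the trivial
  nest, and otherwise \<open>[x, [y, a]]\<close> is a Lie biderivation, which may be subtracted. If \<open>\<phi>(p, p)\<close> is a
  scalar, then \<open>\<phi>\<close> respects the grading, \<open>\<phi>(p, y) = \<lambda> y\<close> on \<open>T\<^sub>1\<close>, and the identity
  \<open>[\<phi>(x, y), [u, v]] + [\<phi>(u, v), [x, y]] = [\<phi>(x, v), [u, y]] + [\<phi>(u, y), [x, v]]\<close>
  propagates \<open>\<phi> = \<lambda> [_, _]\<close>, up to scalars, to all components. The dimension hypothesis enters as
  \<open>T\<^sub>0 \<noteq> \<complex> p + \<complex> (1 - p)\<close>.\<close>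

section \<open>Lie biderivations and Peirce decompositions\<close>

lemma commutator_add_left: "commutator (x + y) z = commutator x z + commutator y z"
  and commutator_add_right: "commutator x (y + z) = commutator x y + commutator x z"
  and commutator_diff_left: "commutator (x - y) z = commutator x z - commutator y z"
  and commutator_diff_right: "commutator x (y - z) = commutator x y - commutator x z"
  and commutator_minus_left: "commutator (- x) y = - commutator x y"
  and commutator_self [simp]: "commutator x x = 0"
  and commutator_zero [simp]: "commutator 0 x = 0" "commutator x 0 = 0"
  by (simp_all add: commutator_def algebra_simps)

lemma commutator_skew: "commutator x y = - commutator y x"
  by (simp add: commutator_def)

lemma commutator_jacobi:
  "commutator x (commutator y z) = commutator (commutator x y) z + commutator y (commutator x z)"
  by (simp add: commutator_def algebra_simps)

lemma commutator_scaleC_left: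
  fixes x y :: "'b::complex_algebra"
  shows "commutator (c *\<^sub>C x) y = c *\<^sub>C commutator x y"
  by (simp add: commutator_def mult_scaleC_left mult_scaleC_right
      complex_vector.scale_right_diff_distrib)

lemma commutator_scaleC_right:
  fixes x y :: "'b::complex_algebra"
  shows "commutator x (c *\<^sub>C y) = c *\<^sub>C commutator x y"
  by (simp add: commutator_def mult_scaleC_left mult_scaleC_right
      complex_vector.scale_right_diff_distrib)

lemmas scaleC_diff_right = complex_vector.scale_right_diff_distrib
lemmas scaleC_diff_left = complex_vector.scale_left_diff_distrib

context
  fixes A :: "'b::complex_algebra set" and \<phi>
  assumes lb: "Lie_biderivation A \<phi>"
begin

lemma Lie_biderivation_closed: "x \<in> A \<Longrightarrow> y \<in> A \<Longrightarrow> \<phi> x y \<in> A"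
  and Lie_biderivation_add_left:
    "x \<in> A \<Longrightarrow> x' \<in> A \<Longrightarrow> y \<in> A \<Longrightarrow> \<phi> (x + x') y = \<phi> x y + \<phi> x' y"
  and Lie_biderivation_add_right:
    "x \<in> A \<Longrightarrow> y \<in> A \<Longrightarrow> y' \<in> A \<Longrightarrow> \<phi> x (y + y') = \<phi> x y + \<phi> x y'"
  and Lie_biderivation_scaleC_left: "x \<in> A \<Longrightarrow> y \<in> A \<Longrightarrow> \<phi> (c *\<^sub>C x) y = c *\<^sub>C \<phi> x y"
  and Lie_biderivation_scaleC_right: "x \<in> A \<Longrightarrow> y \<in> A \<Longrightarrow> \<phi> x (c *\<^sub>C y) = c *\<^sub>C \<phi> x y"
  and Lie_biderivation_commutator_left: "x \<in> A \<Longrightarrow> y \<in> A \<Longrightarrow> z \<in> A \<Longrightarrow>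
    \<phi> (commutator x z) y = commutator (\<phi> x y) z + commutator x (\<phi> z y)"
  and Lie_biderivation_commutator_right: "x \<in> A \<Longrightarrow> y \<in> A \<Longrightarrow> z \<in> A \<Longrightarrow>
    \<phi> x (commutator y z) = commutator (\<phi> x y) z + commutator y (\<phi> x z)"
  using lb by (auto simp: Lie_biderivation_def bilinear_map_on_def)

lemma Lie_biderivation_flip: "Lie_biderivation A (\<lambda>x y. \<phi> y x)"
  using lb by (auto simp: Lie_biderivation_def bilinear_map_on_def)

end

lemma Lie_biderivation_diff:
  assumes phi: "Lie_biderivation A \<phi>" and psi: "Lie_biderivation A \<psi>"
    and diff: "\<And>x y. x \<in> A \<Longrightarrow> y \<in> A \<Longrightarrow> x - y \<in> A"
  shows "Lie_biderivation A (\<lambda>x y. \<phi> x y - \<psi> x y)"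
  using assms unfolding Lie_biderivation_def bilinear_map_on_def
  by (auto simp: scaleC_diff_right commutator_diff_left commutator_diff_right)

text \<open>Obtained by expanding \<open>\<phi> [x, u] [y, v]\<close> in the two possible orders.\<close>

lemma Lie_biderivation_exchange:
  assumes lb: "Lie_biderivation A \<phi>"
    and comm: "\<And>x y. x \<in> A \<Longrightarrow> y \<in> A \<Longrightarrow> commutator x y \<in> A"
    and xyuv: "x \<in> A" "y \<in> A" "u \<in> A" "v \<in> A"
  shows "commutator (\<phi> x y) (commutator u v) + commutator (\<phi> u v) (commutator x y) =
    commutator (\<phi> x v) (commutator u y) + commutator (\<phi> u y) (commutator x v)"
proof -
  note L = Lie_biderivation_commutator_left[OF lb] Lie_biderivation_commutator_right[OF lb]
  have "commutator (\<phi> x (commutator y v)) u + commutator x (\<phi> u (commutator y v)) =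
      commutator (\<phi> (commutator x u) y) v + commutator y (\<phi> (commutator x u) v)"
    using xyuv comm L(1)[of x "commutator y v" u] L(2)[of "commutator x u" y v] by simp
  then have "commutator (commutator (\<phi> x y) v + commutator y (\<phi> x v)) u
        + commutator x (commutator (\<phi> u y) v + commutator y (\<phi> u v))
      - (commutator (commutator (\<phi> x y) u + commutator x (\<phi> u y)) v
        + commutator y (commutator (\<phi> x v) u + commutator x (\<phi> u v))) = 0"
    using xyuv by (simp add: L)
  moreover have "commutator (commutator (\<phi> x y) v + commutator y (\<phi> x v)) u
        + commutator x (commutator (\<phi> u y) v + commutator y (\<phi> u v))
      - (commutator (commutator (\<phi> x y) u + commutator x (\<phi> u y)) v
        + commutator y (commutator (\<phi> x v) u + commutator x (\<phi> u v)))
     = commutator (\<phi> x v) (commutator u y) + commutator (\<phi> u y) (commutator x v)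
      - (commutator (\<phi> x y) (commutator u v) + commutator (\<phi> u v) (commutator x y))"
    by (simp add: commutator_def algebra_simps)
  ultimately show ?thesis by simp
qed

section \<open>The blocks of an algebra with respect to an idempotent\<close>

definition diag :: "'b::complex_algebra set \<Rightarrow> 'b \<Rightarrow> 'b set" where
  "diag A p = {x\<in>A. p * x = x * p}"

text \<open>The corner \<open>p A (e - p)\<close> for an idempotent \<open>p\<close> of an algebra with unit \<open>e\<close>; the opposite
  corner is \<open>upper A (e - p)\<close>.\<close>

definition upper :: "'b::complex_algebra set \<Rightarrow> 'b \<Rightarrow> 'b set" where
  "upper A p = {x\<in>A. p * x = x \<and> x * p = 0}"

text \<open>The carrier brings its own unit \<open>e\<close>, since the class
  \<open>complex_algebra\<close> does not provide one. The axioms pass from \<open>p\<close> to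
  \<open>e - p\<close>, so the results apply to both corners.\<close>

locale peirce =
  fixes A :: "'b::complex_algebra set" and e p :: 'b
  assumes add_closed [intro, simp]: "x \<in> A \<Longrightarrow> y \<in> A \<Longrightarrow> x + y \<in> A"
    and mult_closed [intro, simp]: "x \<in> A \<Longrightarrow> y \<in> A \<Longrightarrow> x * y \<in> A"
    and scaleC_closed [intro, simp]: "x \<in> A \<Longrightarrow> c *\<^sub>C x \<in> A"
    and unit_closed [intro, simp]: "e \<in> A"
    and unit_left [simp]: "x \<in> A \<Longrightarrow> e * x = x"
    and unit_right [simp]: "x \<in> A \<Longrightarrow> x * e = x"
    and p_closed [intro, simp]: "p \<in> A"
    and p_idem [simp]: "p * p = p"
begin

lemma minus_closed [intro, simp]: "x \<in> A \<Longrightarrow> - x \<in> A"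
  using scaleC_closed[of x "-1"] by (simp add: scaleC_one)

lemma diff_closed [intro, simp]: "x \<in> A \<Longrightarrow> y \<in> A \<Longrightarrow> x - y \<in> A"
  using add_closed[of x "- y"] by simp

lemma commutator_closed [intro, simp]: "x \<in> A \<Longrightarrow> y \<in> A \<Longrightarrow> commutator x y \<in> A"
  by (simp add: commutator_def)

lemma zero_closed [intro, simp]: "0 \<in> A"
  using diff_closed[of e e] by simp

lemma p_idem2 [simp]: "p * (p * x) = p * x"
  by (simp flip: mult.assoc)

lemma diag_closed: "x \<in> diag A p \<Longrightarrow> x \<in> A"
  and upper_closed: "x \<in> upper A p \<Longrightarrow> x \<in> A"
  and diag_add [simp]: "x \<in> diag A p \<Longrightarrow> y \<in> diag A p \<Longrightarrow> x + y \<in> diag A p"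
  and diag_diff [simp]: "x \<in> diag A p \<Longrightarrow> y \<in> diag A p \<Longrightarrow> x - y \<in> diag A p"
  and upper_add [simp]: "x \<in> upper A p \<Longrightarrow> y \<in> upper A p \<Longrightarrow> x + y \<in> upper A p"
  and upper_diff [simp]: "x \<in> upper A p \<Longrightarrow> y \<in> upper A p \<Longrightarrow> x - y \<in> upper A p"
  and diag_scaleC [simp]: "x \<in> diag A p \<Longrightarrow> c *\<^sub>C x \<in> diag A p"
  and upper_scaleC [simp]: "x \<in> upper A p \<Longrightarrow> c *\<^sub>C x \<in> upper A p"
  and zero_diag [simp]: "0 \<in> diag A p"
  and zero_upper [simp]: "0 \<in> upper A p"
  and p_diag [simp]: "p \<in> diag A p"
  and e_diag [simp]: "e \<in> diag A p"
  by (auto simp: diag_def upper_def algebra_simps mult_scaleC_left mult_scaleC_right)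

lemma diag_mult [simp]: "x \<in> diag A p \<Longrightarrow> y \<in> diag A p \<Longrightarrow> x * y \<in> diag A p"
  unfolding diag_def by simp (metis mult.assoc)

lemma diag_mult_upper [simp]: "x \<in> diag A p \<Longrightarrow> y \<in> upper A p \<Longrightarrow> x * y \<in> upper A p"
  unfolding diag_def upper_def by simp (metis mult.assoc mult_zero_right)

lemma upper_mult_diag [simp]: "x \<in> diag A p \<Longrightarrow> y \<in> upper A p \<Longrightarrow> y * x \<in> upper A p"
  unfolding diag_def upper_def by simp (metis mult.assoc mult_zero_left)

lemma commutator_diag [simp]: "x \<in> diag A p \<Longrightarrow> y \<in> diag A p \<Longrightarrow> commutator x y \<in> diag A p"
  by (simp add: commutator_def)

lemma commutator_diag_upper [simp]:
  assumes "x \<in> diag A p" "y \<in> upper A p"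
  shows "commutator x y \<in> upper A p" "commutator y x \<in> upper A p"
  using assms by (simp_all add: commutator_def)

lemma commutator_upper_upper: "x \<in> upper A p \<Longrightarrow> y \<in> upper A p \<Longrightarrow> commutator x y = 0"
  unfolding commutator_def upper_def
  by simp (metis (no_types, lifting) mult.assoc mult_zero_left)

lemma commutator_p_diag [simp]: "x \<in> diag A p \<Longrightarrow> commutator p x = 0" "x \<in> diag A p \<Longrightarrow> commutator x p = 0"
  by (auto simp: diag_def commutator_def)

lemma commutator_p_upper [simp]: "x \<in> upper A p \<Longrightarrow> commutator p x = x" "x \<in> upper A p \<Longrightarrow> commutator x p = - x"
  by (auto simp: upper_def commutator_def)

lemma diag_complement: "diag A (e - p) = diag A p"
  by (auto simp: diag_def left_diff_distrib right_diff_distrib)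

lemma upper_complement: "upper A (e - p) = {x\<in>A. p * x = 0 \<and> x * p = x}"
  by (auto simp: upper_def left_diff_distrib right_diff_distrib)

lemma peirce_decomposition:
  assumes x: "x \<in> A"
  obtains b u v where "b \<in> diag A p" "u \<in> upper A p" "v \<in> upper A (e - p)" "x = b + (u + v)"
proof
  let ?q = "e - p"
  have qp: "?q * p = 0" "p * ?q = 0" by (simp_all add: left_diff_distrib right_diff_distrib)
  have qp': "?q * (p * z) = 0" "p * (?q * z) = 0" for z
    by (simp_all add: qp flip: mult.assoc)
  show "p * x * p + ?q * x * ?q \<in> diag A p"
    using x by (simp add: diag_def distrib_left distrib_right mult.assoc qp qp')
  show "p * x * ?q \<in> upper A p" using x by (simp add: upper_def mult.assoc qp)
  show "?q * x * p \<in> upper A ?q" using x by (simp add: upper_complement mult.assoc qp')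
  show "x = p * x * p + ?q * x * ?q + (p * x * ?q + ?q * x * p)"
    using x by (simp add: algebra_simps)
qed

lemma diagI: "x \<in> A \<Longrightarrow> commutator p x = 0 \<Longrightarrow> x \<in> diag A p"
  by (simp add: diag_def commutator_def)

text \<open>The map \<open>[p, _]\<close> fixes the upper block, negates the lower one and kills the
  diagonal, so comparing blocks leaves only the upper block of \<open>w\<close>. Such equations
  arise from expanding \<open>\<phi>\<close> at \<open>[p, x]\<close> for \<open>x\<close> in the
  corner.\<close>

lemma upper_offset:
  assumes "w \<in> A" "z \<in> upper A p" "w = z + commutator p w"
  shows "z = 0" "w \<in> upper A p"
proof -
  have "p * w = z + p * w - p * w * p"
    using arg_cong[OF assms(3), of "\<lambda>t. p * t"] assms(2)
    by (simp add: commutator_def upper_def algebra_simps)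
  \<comment> \<open>\<open>z\<close> lies in the corner and in \<open>p A p\<close>, which meet only
    in zero.\<close>
  then have z: "z = p * w * p" by simp
  then have "z * p = z" by (simp add: mult.assoc)
  then show z0: "z = 0" using assms(2) by (simp add: upper_def)
  then have pwp: "p * w * p = 0" using z by simp
  have w: "w = p * w - w * p" using assms(3) z0 by (simp add: commutator_def)
  then have "w * p = p * w * p - w * p * p" by (metis left_diff_distrib)
  then have "w * p = - (w * p)" using pwp by (simp add: mult.assoc)
  then have "w * p + w * p = 0" by (metis add.right_inverse)
  then have "2 *\<^sub>C (w * p) = 0"
    by (metis scaleC_add_left scaleC_one one_add_one)
  then have "w * p = 0" by simp
  then show "w \<in> upper A p" using w assms(1) by (simp add: upper_def)
qed

lemma upperI: "w \<in> A \<Longrightarrow> w = commutator p w \<Longrightarrow> w \<in> upper A p"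
  using upper_offset(2)[of w 0] by (simp add: upper_def)

end

section \<open>Peirce decompositions with a scalar corner\<close>

text \<open>What the algebraic part uses about operators: the corner is a faithful bimodule over the
  diagonal blocks, with only scalar endomorphisms. The opposite corner is left open, so that the
  locale covers both the case where it vanishes and the full operator algebra.\<close>

locale peirce_scalar = peirce +
  assumes faithful_left: "\<And>d. d \<in> A \<Longrightarrow> (\<And>y. y \<in> upper A p \<Longrightarrow> d * y = 0) \<Longrightarrow> d * p = 0"
    and faithful_right: "\<And>d. d \<in> A \<Longrightarrow> (\<And>y. y \<in> upper A p \<Longrightarrow> y * d = 0) \<Longrightarrow> p * d = d"
    and endo_scalar: "\<And>S. (\<And>y. y \<in> upper A p \<Longrightarrow> S y \<in> upper A p) \<Longrightarrow>
      (\<And>y z. y \<in> upper A p \<Longrightarrow> z \<in> upper A p \<Longrightarrow> S (y + z) = S y + S z) \<Longrightarrow>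
      (\<And>c y. y \<in> upper A p \<Longrightarrow> S (c *\<^sub>C y) = c *\<^sub>C S y) \<Longrightarrow>
      (\<And>b y. b \<in> diag A p \<Longrightarrow> y \<in> upper A p \<Longrightarrow> S (commutator b y) = commutator b (S y)) \<Longrightarrow>
      \<exists>c. \<forall>y\<in>upper A p. S y = c *\<^sub>C y"
    and diag_nontrivial: "\<exists>b\<in>diag A p. \<forall>c d. b \<noteq> c *\<^sub>C p + d *\<^sub>C e"
begin

section \<open>Centralizers in the diagonal and the size of the corner\<close>

abbreviation "scalars \<equiv> complex_vector.span {e}"

lemma scalars_iff: "x \<in> scalars \<longleftrightarrow> (\<exists>c. x = c *\<^sub>C e)"
  by (auto simp: complex_vector.span_singleton)

lemma scalars_diag: "x \<in> scalars \<Longrightarrow> x \<in> diag A p"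
  by (auto simp: scalars_iff)

lemma commutator_scalars [simp]:
  "x \<in> scalars \<Longrightarrow> y \<in> A \<Longrightarrow> commutator x y = 0"
  "x \<in> scalars \<Longrightarrow> y \<in> A \<Longrightarrow> commutator y x = 0"
  by (auto simp: scalars_iff commutator_def mult_scaleC_left mult_scaleC_right)

lemmas scalars_add = complex_vector.span_add[of _ "{e}"]
lemmas scalars_diff = complex_vector.span_diff[of _ "{e}"]
lemmas scalars_scale = complex_vector.span_scale[of _ "{e}"]

lemma p_nonzero: "p \<noteq> 0"
proof
  assume p: "p = 0"
  have "p * e = e" by (rule faithful_right) (auto simp: upper_def p)
  then have "e = 0" using p by simp
  then have "b = 0" if "b \<in> A" for b using unit_left[OF that] by simp
  then show False using diag_nontrivial p by (force simp: diag_def)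
qed

lemma p_noteq_e: "p \<noteq> e"
proof
  assume p: "p = e"
  have "e * p = 0" by (rule faithful_left) (use unit_right in \<open>fastforce simp: upper_def p\<close>)+
  then show False using p_nonzero by (simp add: p)
qed

lemma upper_nonzero: "\<exists>y\<in>upper A p. y \<noteq> 0"
proof (rule ccontr)
  assume "\<not> ?thesis"
  then have "p * p = 0" by (intro faithful_left) auto
  then show False using p_nonzero by simp
qed

lemma left_scalar:
  assumes "d \<in> A" "\<And>y. y \<in> upper A p \<Longrightarrow> d * y = c *\<^sub>C y"
  shows "d * p = c *\<^sub>C p"
proof -
  have "(d - c *\<^sub>C e) * p = 0"
    by (rule faithful_left) (use assms upper_closed in \<open>auto simp: left_diff_distrib mult_scaleC_left\<close>)
  then show ?thesis by (simp add: left_diff_distrib mult_scaleC_left)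
qed

lemma right_scalar:
  assumes "d \<in> A" "\<And>y. y \<in> upper A p \<Longrightarrow> y * d = c *\<^sub>C y"
  shows "p * (d - c *\<^sub>C e) = d - c *\<^sub>C e"
  by (rule faithful_right) (use assms upper_closed in \<open>auto simp: right_diff_distrib mult_scaleC_right\<close>)

text \<open>On the corner, left and right multiplication by \<open>d\<close> agree, so left
  multiplication by \<open>d\<close> commutes with every \<open>[b, _]\<close> and is a scalar
  \<open>c\<close>. Faithfulness on the two sides gives \<open>d p = c p\<close> and
  \<open>(e - p) d = c (e - p)\<close>.\<close>

lemma diag_commute_upper_scalar:
  assumes d: "d \<in> diag A p" and comm: "\<And>y. y \<in> upper A p \<Longrightarrow> commutator d y = 0"
  shows "d \<in> scalars"
proof -
  have dy: "d * y = y * d" if "y \<in> upper A p" for y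
    using comm[OF that] by (simp add: commutator_def)
  have "\<exists>c. \<forall>y\<in>upper A p. d * y = c *\<^sub>C y"
  proof (rule endo_scalar)
    fix b y assume h: "b \<in> diag A p" "y \<in> upper A p"
    have "d * (b * y) = b * y * d" "y * d = d * y"
      using h by (simp_all add: dy)
    then show "d * commutator b y = commutator b (d * y)"
      by (simp add: commutator_def right_diff_distrib mult.assoc)
  qed (use d in \<open>auto simp: distrib_left mult_scaleC_right\<close>)
  then obtain c where c: "d * y = c *\<^sub>C y" if "y \<in> upper A p" for y by blast
  have "d * p = c *\<^sub>C p"
    using d c by (intro left_scalar) (auto simp: diag_closed)
  moreover have "p * (d - c *\<^sub>C e) = d - c *\<^sub>C e"
    using d c by (intro right_scalar) (auto simp: diag_closed dy[symmetric])
  ultimately have "d = c *\<^sub>C e"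
    using d by (simp add: diag_def right_diff_distrib mult_scaleC_right)
  then show ?thesis by (auto simp: scalars_iff)
qed

text \<open>Left and right multiplication by a central \<open>d\<close> are both endomorphisms of
  the corner, but their scalars \<open>c\<close> and \<open>c'\<close> may differ, so
  \<open>d = c p + c' (e - p)\<close>.\<close>

lemma diag_center:
  assumes d: "d \<in> diag A p" and comm: "\<And>b. b \<in> diag A p \<Longrightarrow> commutator d b = 0"
  shows "\<exists>c c'. d = c *\<^sub>C p + c' *\<^sub>C e"
proof -
  have db: "d * b = b * d" if "b \<in> diag A p" for b
    using comm[OF that] by (simp add: commutator_def)
  have "\<exists>c. \<forall>y\<in>upper A p. d * y = c *\<^sub>C y"
  proof (rule endo_scalar)
    fix b y assume h: "b \<in> diag A p" "y \<in> upper A p"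
    then show "d * commutator b y = commutator b (d * y)"
      by (simp add: commutator_def right_diff_distrib db flip: mult.assoc)
  qed (use d in \<open>auto simp: distrib_left mult_scaleC_right\<close>)
  then obtain c where c: "d * y = c *\<^sub>C y" if "y \<in> upper A p" for y by blast
  have "\<exists>c. \<forall>y\<in>upper A p. y * d = c *\<^sub>C y"
  proof (rule endo_scalar)
    fix b y assume h: "b \<in> diag A p" "y \<in> upper A p"
    then show "commutator b y * d = commutator b (y * d)"
      by (simp add: commutator_def left_diff_distrib db mult.assoc)
  qed (use d in \<open>auto simp: distrib_right mult_scaleC_left\<close>)
  then obtain c' where c': "y * d = c' *\<^sub>C y" if "y \<in> upper A p" for y by blast
  have "d * p = c *\<^sub>C p"
    using d c by (intro left_scalar) (auto simp: diag_closed)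
  moreover have "p * (d - c' *\<^sub>C e) = d - c' *\<^sub>C e"
    using d c' by (intro right_scalar) (auto simp: diag_closed)
  ultimately have "d = (c - c') *\<^sub>C p + c' *\<^sub>C e"
    using d by (simp add: diag_def right_diff_distrib mult_scaleC_right scaleC_diff_left algebra_simps)
  then show ?thesis by blast
qed

text \<open>As \<open>d\<close> commutes with \<open>p\<close>, replacing \<open>b\<close> by
  \<open>p b\<close> multiplies \<open>[d, b]\<close> by \<open>p\<close>. If both values are
  scalars, then \<open>s p = s' e\<close>, which forces \<open>s = 0\<close> because
  \<open>p\<close> is neither \<open>0\<close> nor \<open>e\<close>.\<close>

lemma commutator_scalar_imp_zero:
  assumes d: "d \<in> diag A p" and b: "b \<in> diag A p"
    and sc: "\<And>b. b \<in> diag A p \<Longrightarrow> commutator d b \<in> scalars"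
  shows "commutator d b = 0"
proof -
  obtain s where s: "commutator d b = s *\<^sub>C e" using sc[OF b] by (auto simp: scalars_iff)
  obtain s' where s': "commutator d (p * b) = s' *\<^sub>C e"
    using sc[of "p * b"] b by (auto simp: scalars_iff)
  have "d * (p * b) = p * (d * b)"
    using d by (simp add: diag_def flip: mult.assoc)
  then have "commutator d (p * b) = p * commutator d b"
    by (simp add: commutator_def right_diff_distrib mult.assoc)
  then have eq: "s *\<^sub>C p = s' *\<^sub>C e" by (simp add: s s' mult_scaleC_right)
  then have "p * (s *\<^sub>C p) = p * (s' *\<^sub>C e)" by simp
  then have "s *\<^sub>C p = s' *\<^sub>C p" by (simp add: mult_scaleC_right)
  then have "s = s'" "s' *\<^sub>C e = s' *\<^sub>C p"
    using p_nonzero eq by (auto)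
  then have "s = 0" using p_noteq_e by auto
  then show ?thesis by (simp add: s)
qed

text \<open>If all commutators were scalars they would vanish, and every element of the then
  commutative diagonal would be a combination of \<open>p\<close> and \<open>e\<close>.\<close>

lemma commutator_nonscalar: "\<exists>b\<in>diag A p. \<exists>b'\<in>diag A p. commutator b b' \<notin> scalars"
proof (rule ccontr)
  assume neg: "\<not> ?thesis"
  obtain b where b: "b \<in> diag A p" "\<And>c d. b \<noteq> c *\<^sub>C p + d *\<^sub>C e"
    using diag_nontrivial by blast
  have "commutator b b' = 0" if "b' \<in> diag A p" for b'
    by (rule commutator_scalar_imp_zero) (use b neg that in auto)
  then show False using diag_center[of b] b by blast
qed

text \<open>On a corner of dimension one each \<open>b\<close> in the diagonal acts by a scalar from
  either side, hence is a combination of \<open>p\<close> and \<open>e\<close>, which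
  \<open>diag_nontrivial\<close> excludes.\<close>

lemma upper_not_one_dim: "\<exists>x\<in>upper A p. \<forall>c. x \<noteq> c *\<^sub>C y"
proof (rule ccontr)
  assume neg: "\<not> ?thesis"
  then have gen: "\<exists>c. x = c *\<^sub>C y" if "x \<in> upper A p" for x using that by blast
  \<comment> \<open>\<open>y\<close> is not known to lie in the corner, so it is replaced by a
    nonzero corner element, which lies on the same line.\<close>
  obtain y0 where y0: "y0 \<in> upper A p" "y0 \<noteq> 0" using upper_nonzero by blast
  then obtain c0 where c0: "y0 = c0 *\<^sub>C y" using gen by blast
  then have "c0 \<noteq> 0" using y0 by auto
  have gen0: "\<exists>c. x = c *\<^sub>C y0" if x: "x \<in> upper A p" for x
  proof -
    obtain c where "x = c *\<^sub>C y" using gen x by blast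
    then have "x = (c / c0) *\<^sub>C y0" using \<open>c0 \<noteq> 0\<close> by (simp add: c0 scaleC_scaleC)
    then show ?thesis by blast
  qed
  obtain b where b: "b \<in> diag A p" "\<And>c d. b \<noteq> c *\<^sub>C p + d *\<^sub>C e"
    using diag_nontrivial by blast
  obtain c where c: "b * y0 = c *\<^sub>C y0" using gen0 b y0 by (meson diag_mult_upper)
  obtain c' where c': "y0 * b = c' *\<^sub>C y0" using gen0 b y0 by (meson upper_mult_diag)
  have "b * p = c *\<^sub>C p"
  proof (rule left_scalar)
    fix x assume "x \<in> upper A p"
    then obtain t where "x = t *\<^sub>C y0" using gen0 by blast
    then show "b * x = c *\<^sub>C x" by (simp add: mult_scaleC_right c scaleC_scaleC mult.commute)
  qed (use b diag_closed in auto)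
  moreover have "p * (b - c' *\<^sub>C e) = b - c' *\<^sub>C e"
  proof (rule right_scalar)
    fix x assume "x \<in> upper A p"
    then obtain t where "x = t *\<^sub>C y0" using gen0 by blast
    then show "x * b = c' *\<^sub>C x" by (simp add: mult_scaleC_left c' scaleC_scaleC mult.commute)
  qed (use b diag_closed in auto)
  ultimately have "b = (c - c') *\<^sub>C p + c' *\<^sub>C e"
    using b(1) by (simp add: diag_def right_diff_distrib mult_scaleC_right scaleC_diff_left algebra_simps)
  then show False using b by blast
qed

section \<open>The value of a Lie biderivation at \<open>(p, p)\<close>\<close>

context
  fixes \<phi>
  assumes lb: "Lie_biderivation A \<phi>"
begin

lemmas phi_closed = Lie_biderivation_closed[OF lb]
lemmas phi_L = Lie_biderivation_commutator_left[OF lb]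
lemmas phi_R = Lie_biderivation_commutator_right[OF lb]

text \<open>Expanding \<open>\<phi> b [p, b'] = 0\<close> and \<open>\<phi> [p, b] b' = 0\<close> gives
  \<open>[\<phi> b p, b'] = [\<phi> p b', b]\<close>; bracketing with \<open>p\<close> and using the Jacobi identity yields the
  second claim.\<close>

lemma off_diagonal_corner:
  assumes pp: "\<phi> p p = c + k" and c: "c \<in> diag A p"
    and k: "k = m + n" "m \<in> upper A p" "n \<in> upper A (e - p)"
  shows "c \<in> scalars"
    and "b \<in> diag A p \<Longrightarrow> b' \<in> diag A p \<Longrightarrow> commutator (commutator b b') k = 0"
proof -
  have mA: "m \<in> A" "n \<in> A" "c \<in> A" using k c by (auto simp: upper_def diag_def)
  have pk: "commutator p k = m - n"
    using k mA by (simp add: commutator_def upper_def algebra_simps)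
  show sc: "c \<in> scalars"
  proof (rule diag_commute_upper_scalar[OF c])
    fix x assume x: "x \<in> upper A p"
    then have xA: "x \<in> A" by (rule upper_closed)
    define w where "w = \<phi> p x"
    have wA: "w \<in> A" using phi_closed xA w_def by simp
    have "w = commutator (\<phi> p p) x + commutator p w"
      using phi_R[of p p x] xA x by (simp add: w_def)
    then have w: "w = commutator c x + commutator n x + commutator p w"
      by (simp add: pp k commutator_add_left commutator_upper_upper x)
    have nx: "p * n = 0" "n * p = n"
      using k(3) mA by (auto simp: upper_def algebra_simps)
    have px: "p * x = x" "x * p = 0" using x by (auto simp: upper_def)
    have cx: "p * commutator c x = commutator c x" "commutator c x * p = 0"
      using commutator_diag_upper(1)[OF c x] by (auto simp: upper_def)
    \<comment> \<open>Compression to the upper block: \<open>[n, x]\<close> is diagonal and drops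
      out, \<open>[p, w]\<close> has the same upper block as \<open>w\<close>, and only
      \<open>[c, x]\<close> remains.\<close>
    have "p * (w * (e - p)) = p * (commutator c x * (e - p)) + p * (commutator n x * (e - p)) + p * (commutator p w * (e - p))"
      by (subst (1) w) (simp add: distrib_left distrib_right)
    moreover have "p * (commutator c x * (e - p)) = commutator c x"
      using cx xA mA by (simp add: right_diff_distrib flip: mult.assoc)
    moreover have "p * (commutator n x * (e - p)) = 0"
    proof -
      have "p * commutator n x = - (x * n)"
        using nx px by (simp add: commutator_def right_diff_distrib flip: mult.assoc)
      then show ?thesis
        using nx mA xA by (simp add: right_diff_distrib mult.assoc flip: mult.assoc[of p])
    qed
    moreover have "p * (commutator p w * (e - p)) = p * (w * (e - p))"
    proof -
      have "commutator p w * (e - p) = p * (w * (e - p)) - w * (p * (e - p))"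
        by (simp add: commutator_def left_diff_distrib mult.assoc)
      also have "p * (e - p) = 0" by (simp add: right_diff_distrib)
      finally show ?thesis by simp
    qed
    ultimately show "commutator c x = 0" by simp
  qed
  \<comment> \<open>Expand \<open>\<phi>\<close> with \<open>[p, b] = 0\<close> in one slot and
    \<open>p\<close> in the other; the scalar part \<open>c\<close> of \<open>\<phi> p p\<close>
    contributes nothing.\<close>
  have pb: "commutator p (\<phi> p b) = commutator b k" "commutator p (\<phi> b p) = commutator b k"
    if b: "b \<in> diag A p" for b
  proof -
    have bA: "b \<in> A" using b by (rule diag_closed)
    have z: "\<phi> p 0 = 0" "\<phi> 0 p = 0"
      using Lie_biderivation_scaleC_right[OF lb, of p p 0] Lie_biderivation_scaleC_left[OF lb, of p p 0]
      by simp_all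
    show "commutator p (\<phi> p b) = commutator b k"
      using phi_R[of p p b] bA b sc z
      by (simp add: pp commutator_add_left commutator_skew[of b k] add_eq_0_iff)
    show "commutator p (\<phi> b p) = commutator b k"
      using phi_L[of p p b] bA b sc z
      by (simp add: pp commutator_add_left commutator_skew[of b k] add_eq_0_iff)
  qed
  assume b: "b \<in> diag A p" "b' \<in> diag A p"
  have bA: "b \<in> A" "b' \<in> A" using b by (auto intro: diag_closed)
  have z: "\<phi> b 0 = 0" "\<phi> 0 b' = 0"
    using Lie_biderivation_scaleC_right[OF lb, of b p 0] Lie_biderivation_scaleC_left[OF lb, of p b' 0] bA
    by simp_all
  have "commutator (\<phi> b p) b' + commutator p (\<phi> b b') = 0"
    using phi_R[of b p b'] b bA z by simp
  moreover have "commutator (\<phi> p b') b + commutator p (\<phi> b b') = 0"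
    using phi_L[of p b' b] b bA z by simp
  ultimately have "commutator (\<phi> b p) b' = commutator (\<phi> p b') b"
    by (metis add_right_cancel)
  then have "commutator p (commutator (\<phi> b p) b') = commutator p (commutator (\<phi> p b') b)" by simp
  then have "commutator (commutator b k) b' = commutator (commutator b' k) b"
    using b by (simp add: commutator_jacobi[of p] pb)
  then show "commutator (commutator b b') k = 0"
    by (simp add: commutator_def algebra_simps)
qed

end

section \<open>The diagonal and one corner, when the value at \<open>(p, p)\<close> is
  scalar\<close>

context
  fixes \<phi>
  assumes lb: "Lie_biderivation A \<phi>"
    and pp: "\<phi> p p \<in> scalars"
begin

text \<open>Since \<open>\<phi> p p\<close> is scalar, \<open>\<phi> p\<close> commutes with
  \<open>[p, _]\<close> and preserves its eigenspaces; the diagonal belongs to the eigenvalue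
  \<open>0\<close> and the corner to \<open>1\<close>.\<close>

lemma phi_p_corner:
  shows "b \<in> diag A p \<Longrightarrow> \<phi> p b \<in> diag A p"
    and "y \<in> upper A p \<Longrightarrow> \<phi> p y \<in> upper A p"
proof -
  assume b: "b \<in> diag A p"
  then have bA: "b \<in> A" by (rule diag_closed)
  have z: "\<phi> p 0 = 0" using Lie_biderivation_scaleC_right[OF lb, of p p 0] by simp
  show "\<phi> p b \<in> diag A p"
    using phi_R[OF lb, of p p b] bA b pp z phi_closed[OF lb, of p b] by (intro diagI) auto
next
  assume y: "y \<in> upper A p"
  then have yA: "y \<in> A" by (rule upper_closed)
  show "\<phi> p y \<in> upper A p"
    using phi_R[OF lb, of p p y] y yA pp phi_closed[OF lb, of p y] by (intro upperI) auto
qed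

text \<open>Write \<open>x = [p, x]\<close> and expand; \<open>[\<phi> p y, x]\<close> vanishes
  because both entries lie in the corner.\<close>

lemma phi_upper_upper_closed:
  assumes "x \<in> upper A p" "y \<in> upper A p"
  shows "\<phi> x y \<in> upper A p"
proof -
  have xyA: "x \<in> A" "y \<in> A" using assms by (auto intro: upper_closed)
  have "\<phi> x y = commutator (\<phi> p y) x + commutator p (\<phi> x y)"
    using phi_L[OF lb, of p y x] assms xyA by simp
  then show ?thesis
    using phi_p_corner(2)[OF assms(2)] assms xyA phi_closed[OF lb]
    by (intro upperI) (auto simp: commutator_upper_upper)
qed

end

text \<open>Expanding \<open>\<phi> b [p, y]\<close> gives
  \<open>w = [\<phi> b p, y] + [p, w]\<close> with \<open>w = \<phi> b y\<close>, and
  \<open>upper_offset\<close> settles both claims at once: \<open>w\<close> lies in the corner, and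
  \<open>\<phi> b p\<close> commutes with \<open>y\<close>.\<close>

lemma phi_diag_p_scalar:
  assumes lb: "Lie_biderivation A \<phi>" and pp: "\<phi> p p \<in> scalars" and b: "b \<in> diag A p"
  shows "\<phi> b p \<in> scalars" and "y \<in> upper A p \<Longrightarrow> \<phi> b y \<in> upper A p"
proof -
  have bA: "b \<in> A" using b by (rule diag_closed)
  have bp: "\<phi> b p \<in> diag A p"
    using phi_p_corner(1)[OF Lie_biderivation_flip[OF lb]] pp b by simp
  have main: "commutator (\<phi> b p) y = 0 \<and> \<phi> b y \<in> upper A p" if y: "y \<in> upper A p" for y
  proof -
    have yA: "y \<in> A" using y by (rule upper_closed)
    have eq: "\<phi> b y = commutator (\<phi> b p) y + commutator p (\<phi> b y)"
      using phi_R[OF lb, of b p y] y yA bA by simp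
    show ?thesis
      using upper_offset[OF phi_closed[OF lb bA yA] _ eq] bp y by simp
  qed
  then show "\<phi> b p \<in> scalars" using bp by (intro diag_commute_upper_scalar) auto
  show "\<phi> b y \<in> upper A p" if "y \<in> upper A p" using main that by simp
qed

lemma phi_diag_diag_closed:
  assumes lb: "Lie_biderivation A \<phi>" and pp: "\<phi> p p \<in> scalars"
    and b: "b \<in> diag A p" "b' \<in> diag A p"
  shows "\<phi> b b' \<in> diag A p"
proof -
  have bA: "b \<in> A" "b' \<in> A" using b by (auto intro: diag_closed)
  have z: "\<phi> b 0 = 0" using Lie_biderivation_scaleC_right[OF lb, of b p 0] bA by simp
  show ?thesis
    using phi_R[OF lb, of b p b'] bA b z phi_closed[OF lb] phi_diag_p_scalar(1)[OF lb pp b(1)]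
    by (intro diagI) auto
qed

text \<open>The constant \<open>l\<close> is the scalar by which \<open>\<phi> p\<close> acts on the
  corner. In the exchange identity for \<open>p, y, b, b'\<close> the right-hand side vanishes,
  leaving \<open>l [y, [b, b']] + [\<phi> b b', y] = 0\<close>; thus the difference commutes with
  the corner.\<close>

lemma phi_diag_diag:
  assumes lb: "Lie_biderivation A \<phi>" and pp: "\<phi> p p \<in> scalars"
  shows "\<exists>l. \<forall>b\<in>diag A p. \<forall>b'\<in>diag A p. \<phi> b b' - l *\<^sub>C commutator b b' \<in> scalars"
proof -
  note lb' = Lie_biderivation_flip[OF lb]
  have "\<exists>c. \<forall>y\<in>upper A p. \<phi> p y = c *\<^sub>C y"
  proof (rule endo_scalar)
    fix b y assume h: "b \<in> diag A p" "y \<in> upper A p"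
    then have A: "b \<in> A" "y \<in> A" by (auto intro: upper_closed diag_closed)
    have "\<phi> p b \<in> scalars" using phi_diag_p_scalar(1)[OF lb'] pp h by simp
    then show "\<phi> p (commutator b y) = commutator b (\<phi> p y)"
      using phi_R[OF lb, of p b y] A by simp
  qed (use phi_p_corner(2)[OF lb pp] Lie_biderivation_add_right[OF lb] Lie_biderivation_scaleC_right[OF lb]
      upper_closed in auto)
  then obtain l where l: "\<And>y. y \<in> upper A p \<Longrightarrow> \<phi> p y = l *\<^sub>C y" by blast
  have "\<phi> b b' - l *\<^sub>C commutator b b' \<in> scalars"
    if b: "b \<in> diag A p" "b' \<in> diag A p" for b b'
  proof (rule diag_commute_upper_scalar)
    show "\<phi> b b' - l *\<^sub>C commutator b b' \<in> diag A p"
      using b phi_diag_diag_closed[OF lb pp] by simp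
    fix y assume y: "y \<in> upper A p"
    have A: "b \<in> A" "b' \<in> A" "y \<in> A" using b y by (auto intro: upper_closed diag_closed)
    have "commutator (\<phi> p y) (commutator b b') + commutator (\<phi> b b') (commutator p y) =
        commutator (\<phi> p b') (commutator b y) + commutator (\<phi> b y) (commutator p b')"
      by (rule Lie_biderivation_exchange[OF lb]) (use A in auto)
    moreover have "\<phi> p b' \<in> scalars" using phi_diag_p_scalar(1)[OF lb'] pp b by simp
    ultimately have "l *\<^sub>C commutator y (commutator b b') + commutator (\<phi> b b') y = 0"
      using A y b by (simp add: l commutator_scaleC_left)
    then show "commutator (\<phi> b b' - l *\<^sub>C commutator b b') y = 0"
      by (simp add: commutator_diff_left commutator_scaleC_left
          commutator_skew[of y "commutator b b'"] algebra_simps)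
  qed
  then show ?thesis by blast
qed

text \<open>On the corner, \<open>\<phi> b\<close> differs from \<open>l [b, _]\<close> by a scalar \<open>g b\<close>. The exchange identity makes
  \<open>g c b - g b c\<close> central in the diagonal, which is too large for \<open>g\<close> to be nonzero.\<close>

lemma phi_diag_upper:
  assumes lb: "Lie_biderivation A \<phi>" and pp: "\<phi> p p \<in> scalars"
    and l: "\<And>b b'. b \<in> diag A p \<Longrightarrow> b' \<in> diag A p \<Longrightarrow> \<phi> b b' - l *\<^sub>C commutator b b' \<in> scalars"
    and b: "b \<in> diag A p" and y: "y \<in> upper A p"
  shows "\<phi> b y = l *\<^sub>C commutator b y"
proof -
  have phibb: "commutator (\<phi> b b') z = l *\<^sub>C commutator (commutator b b') z"
    if "b \<in> diag A p" "b' \<in> diag A p" "z \<in> A" for b b' z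
  proof -
    have "commutator (\<phi> b b' - l *\<^sub>C commutator b b') z = 0" using l that by simp
    then show ?thesis by (simp add: commutator_diff_left commutator_scaleC_left)
  qed
  have "\<exists>g. \<forall>y\<in>upper A p. \<phi> b y - l *\<^sub>C commutator b y = g *\<^sub>C y" if b: "b \<in> diag A p" for b
  proof (rule endo_scalar)
    have bA: "b \<in> A" using b by (rule diag_closed)
    show "\<phi> b y - l *\<^sub>C commutator b y \<in> upper A p" if "y \<in> upper A p" for y
      using phi_diag_p_scalar(2)[OF lb pp b that] b that by simp
    show "\<phi> b (y + z) - l *\<^sub>C commutator b (y + z) = \<phi> b y - l *\<^sub>C commutator b y + (\<phi> b z - l *\<^sub>C commutator b z)"
      if "y \<in> upper A p" "z \<in> upper A p" for y z
      using that bA Lie_biderivation_add_right[OF lb, of b y z]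
      by (simp add: upper_closed commutator_add_right scaleC_add_right)
    show "\<phi> b (c *\<^sub>C y) - l *\<^sub>C commutator b (c *\<^sub>C y) = c *\<^sub>C (\<phi> b y - l *\<^sub>C commutator b y)"
      if "y \<in> upper A p" for c y
      using that bA Lie_biderivation_scaleC_right[OF lb, of b y c]
      by (simp add: upper_closed commutator_scaleC_right scaleC_diff_right scaleC_scaleC mult.commute)
    fix b' y assume h: "b' \<in> diag A p" "y \<in> upper A p"
    then have A: "b' \<in> A" "y \<in> A" by (auto intro: upper_closed diag_closed)
    have "\<phi> b (commutator b' y) = l *\<^sub>C commutator (commutator b b') y + commutator b' (\<phi> b y)"
      using phi_R[OF lb, of b b' y] A bA b h by (simp add: phibb)
    then show "\<phi> b (commutator b' y) - l *\<^sub>C commutator b (commutator b' y)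
        = commutator b' (\<phi> b y - l *\<^sub>C commutator b y)"
      by (simp add: commutator_jacobi[of b b' y] scaleC_add_right commutator_diff_right commutator_scaleC_right)
  qed
  then obtain g where g: "\<And>b y. b \<in> diag A p \<Longrightarrow> y \<in> upper A p \<Longrightarrow>
      \<phi> b y = l *\<^sub>C commutator b y + g b *\<^sub>C y"
    by (metis add.commute diff_add_cancel)
  have g0: "g c = 0" if c: "c \<in> diag A p" for c
  proof (rule ccontr)
    assume gc: "g c \<noteq> 0"
    have cA: "c \<in> A" using c by (rule diag_closed)
    have span: "\<exists>s t. g c *\<^sub>C b = g b *\<^sub>C c + (s *\<^sub>C p + t *\<^sub>C e)" if b: "b \<in> diag A p" for b
    proof -
      have bA: "b \<in> A" using b by (rule diag_closed)
      let ?d = "g c *\<^sub>C b - g b *\<^sub>C c"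
      have d: "?d \<in> diag A p" using b c by simp
      have "commutator ?d b' \<in> scalars" if b': "b' \<in> diag A p" for b'
      proof (rule diag_commute_upper_scalar)
        show "commutator ?d b' \<in> diag A p" using d b' by simp
        fix y assume y: "y \<in> upper A p"
        have A: "b' \<in> A" "y \<in> A" using b' y by (auto intro: upper_closed diag_closed)
        \<comment> \<open>In the exchange identity for \<open>b, b', c, y\<close> the terms with
          \<open>l\<close> cancel by skew symmetry and only those with \<open>g\<close>
          survive.\<close>
        have "commutator (\<phi> b b') (commutator c y) + commutator (\<phi> c y) (commutator b b') =
          commutator (\<phi> b y) (commutator c b') + commutator (\<phi> c b') (commutator b y)"
          by (rule Lie_biderivation_exchange[OF lb]) (use A bA cA in auto)
        then have "l *\<^sub>C commutator (commutator b b') (commutator c y)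
            + l *\<^sub>C commutator (commutator c y) (commutator b b')
            + g c *\<^sub>C commutator y (commutator b b')
          = l *\<^sub>C commutator (commutator b y) (commutator c b')
            + l *\<^sub>C commutator (commutator c b') (commutator b y)
            + g b *\<^sub>C commutator y (commutator c b')"
          using A bA cA b b' c y
          by (simp add: phibb g commutator_add_left commutator_scaleC_left algebra_simps)
        then have eq: "g c *\<^sub>C commutator y (commutator b b') = g b *\<^sub>C commutator y (commutator c b')"
          by (simp add: commutator_skew[of "commutator c y"] commutator_skew[of "commutator b y"])
        have "commutator (commutator ?d b') y = - (g c *\<^sub>C commutator y (commutator b b')
            - g b *\<^sub>C commutator y (commutator c b'))"
          by (simp add: commutator_diff_left commutator_scaleC_left commutator_skew[of _ y]
              commutator_diff_right commutator_scaleC_right)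
        then show "commutator (commutator ?d b') y = 0" by (simp add: eq)
      qed
      then have "commutator ?d b' = 0" if "b' \<in> diag A p" for b'
        by (rule commutator_scalar_imp_zero[OF d that])
      then obtain s t where "?d = s *\<^sub>C p + t *\<^sub>C e" using diag_center[OF d] by blast
      then have "g c *\<^sub>C b = g b *\<^sub>C c + (s *\<^sub>C p + t *\<^sub>C e)" by (simp add: algebra_simps)
      then show ?thesis by blast
    qed
    \<comment> \<open>As \<open>g c \<noteq> 0\<close>, the diagonal is spanned by \<open>c\<close>,
      \<open>p\<close> and \<open>e\<close>, hence commutative, against
      \<open>commutator_nonscalar\<close>.\<close>
    have comm: "commutator c b = 0" if b: "b \<in> diag A p" for b
    proof -
      obtain s t where "g c *\<^sub>C b = g b *\<^sub>C c + (s *\<^sub>C p + t *\<^sub>C e)" using span[OF b] by blast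
      then have "g c *\<^sub>C commutator c b = commutator c (g b *\<^sub>C c + (s *\<^sub>C p + t *\<^sub>C e))"
        by (metis commutator_scaleC_right)
      also have "\<dots> = 0"
        using c cA by (simp add: commutator_add_right commutator_scaleC_right)
          (simp add: commutator_def)
      finally show ?thesis using gc by simp
    qed
    have "commutator b b' = 0" if b: "b \<in> diag A p" "b' \<in> diag A p" for b b'
    proof -
      obtain s t where "g c *\<^sub>C b = g b *\<^sub>C c + (s *\<^sub>C p + t *\<^sub>C e)" using span[OF b(1)] by blast
      then have "g c *\<^sub>C commutator b b' = commutator (g b *\<^sub>C c + (s *\<^sub>C p + t *\<^sub>C e)) b'"
        by (metis commutator_scaleC_left)
      also have "\<dots> = 0"
        using b diag_closed[OF b(2)] comm
        by (simp add: commutator_add_left commutator_scaleC_left) (simp add: commutator_def)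
      finally show ?thesis using gc by simp
    qed
    then show False using commutator_nonscalar complex_vector.span_zero by metis
  qed
  show ?thesis using g[OF b y] g0[OF b] by simp
qed

text \<open>For fixed \<open>y\<close> the map \<open>x \<mapsto> \<phi> x y\<close> is an
  endomorphism of the corner: in the expansion of \<open>\<phi> [b, x] y\<close> the term
  \<open>[\<phi> b y, x]\<close> is a bracket of two corner elements.\<close>

lemma phi_upper_endo:
  assumes lb: "Lie_biderivation A \<phi>" and pp: "\<phi> p p \<in> scalars" and y: "y \<in> upper A p"
  shows "\<exists>c. \<forall>x\<in>upper A p. \<phi> x y = c *\<^sub>C x"
proof (rule endo_scalar)
  have yA: "y \<in> A" using y by (rule upper_closed)
  fix b x assume h: "b \<in> diag A p" "x \<in> upper A p"
  then have A: "b \<in> A" "x \<in> A" by (auto intro: upper_closed diag_closed)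
  have "commutator (\<phi> b y) x = 0"
    using phi_diag_p_scalar(2)[OF lb pp h(1) y] h(2) by (rule commutator_upper_upper)
  then show "\<phi> (commutator b x) y = commutator b (\<phi> x y)"
    using phi_L[OF lb, of b y x] A yA by simp
qed (use y in \<open>simp_all add: phi_upper_upper_closed[OF lb pp] Lie_biderivation_add_left[OF lb]
    Lie_biderivation_scaleC_left[OF lb] upper_closed\<close>)

text \<open>The value at \<open>(x', y)\<close> is a multiple of \<open>x'\<close> and, by symmetry,
  of \<open>y\<close>. Choosing \<open>x'\<close> off the line of \<open>y\<close> makes the scalar
  attached to \<open>y\<close> zero.\<close>

lemma phi_upper_upper:
  assumes lb: "Lie_biderivation A \<phi>" and pp: "\<phi> p p \<in> scalars"
    and x: "x \<in> upper A p" and y: "y \<in> upper A p"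
  shows "\<phi> x y = 0"
proof -
  obtain c where c: "\<And>x. x \<in> upper A p \<Longrightarrow> \<phi> x y = c *\<^sub>C x"
    using phi_upper_endo[OF lb pp y] by blast
  obtain x' where x': "x' \<in> upper A p" "\<And>c. x' \<noteq> c *\<^sub>C y" using upper_not_one_dim by blast
  obtain c' where c': "\<And>y. y \<in> upper A p \<Longrightarrow> \<phi> x' y = c' *\<^sub>C y"
    using phi_upper_endo[OF Lie_biderivation_flip[OF lb] pp x'(1)] by blast
  have "c *\<^sub>C x' = c' *\<^sub>C y" using c[OF x'(1)] c'[OF y] by simp
  then have "inverse c *\<^sub>C (c *\<^sub>C x') = (inverse c * c') *\<^sub>C y" by (simp add: scaleC_scaleC)
  then have "c = 0" using x'(2)[of "inverse c * c'"] by (cases "c = 0") (simp_all add: scaleC_scaleC scaleC_one)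
  then show ?thesis using c[OF x] by simp
qed

text \<open>The flipped map has its own constant \<open>l'\<close>. Both describe
  \<open>\<phi> b b'\<close> on the diagonal, so \<open>(l + l') [b, b']\<close> is a scalar; a
  nonscalar commutator forces \<open>l' = - l\<close>, and the results for the flipped map carry
  over to \<open>\<phi> y b\<close>.\<close>

proposition Lie_biderivation_triangular_part:
  assumes lb: "Lie_biderivation A \<phi>" and pp: "\<phi> p p \<in> scalars"
  shows "\<exists>l. (\<forall>b\<in>diag A p. \<forall>b'\<in>diag A p. \<phi> b b' - l *\<^sub>C commutator b b' \<in> scalars) \<and>
    (\<forall>b\<in>diag A p. \<forall>y\<in>upper A p. \<phi> b y = l *\<^sub>C commutator b y \<and> \<phi> y b = l *\<^sub>C commutator y b) \<and>
    (\<forall>x\<in>upper A p. \<forall>y\<in>upper A p. \<phi> x y = 0)"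
proof -
  note lb' = Lie_biderivation_flip[OF lb]
  obtain l where l: "\<And>b b'. b \<in> diag A p \<Longrightarrow> b' \<in> diag A p \<Longrightarrow> \<phi> b b' - l *\<^sub>C commutator b b' \<in> scalars"
    using phi_diag_diag[OF lb pp] by blast
  obtain l' where l': "\<And>b b'. b \<in> diag A p \<Longrightarrow> b' \<in> diag A p \<Longrightarrow> \<phi> b' b - l' *\<^sub>C commutator b b' \<in> scalars"
    using phi_diag_diag[OF lb' pp] by blast
  obtain b b' where b: "b \<in> diag A p" "b' \<in> diag A p" "commutator b b' \<notin> scalars"
    using commutator_nonscalar by blast
  have "(\<phi> b b' - l' *\<^sub>C commutator b' b) - (\<phi> b b' - l *\<^sub>C commutator b b') \<in> scalars"
    using b by (intro scalars_diff l l')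
  then have "(l + l') *\<^sub>C commutator b b' \<in> scalars"
    by (simp add: commutator_skew[of b' b] scaleC_add_left algebra_simps)
  then have "inverse (l + l') *\<^sub>C ((l + l') *\<^sub>C commutator b b') \<in> scalars" by (rule scalars_scale)
  then have "l' = - l" using b(3)
    by (cases "l + l' = 0") (simp_all add: scaleC_scaleC scaleC_one add_eq_0_iff)
  then have "\<phi> b' b - (- l) *\<^sub>C commutator b b' \<in> scalars" if "b \<in> diag A p" "b' \<in> diag A p" for b b'
    using l'[OF that] by simp
  note L' = phi_diag_upper[OF lb' pp this]
  have "\<phi> y b = l *\<^sub>C commutator y b" if "b \<in> diag A p" "y \<in> upper A p" for b y
    using L'[OF _ _ that] by (simp add: commutator_skew[of y b])
  then show ?thesis
    using l phi_diag_upper[OF lb pp l] phi_upper_upper[OF lb pp]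
    by (intro exI[of _ l] conjI ballI) assumption+
qed

end

text \<open>As \<open>[_, m]\<close> kills commutators, the Jacobi identity makes
  \<open>[x, [y, m]]\<close> symmetric, and a second round makes \<open>[z, [x, [y, m]]]\<close>
  symmetric in all three arguments. This is the Leibniz rule in \<open>y\<close>, where
  \<open>[x, [[y, z], m]]\<close> is zero. The rule in \<open>x\<close> holds with any element in
  place of \<open>[y, m]\<close>.\<close>

lemma (in peirce) extremal_Lie_biderivation:
  assumes m: "m \<in> A" and z: "\<And>x y. x \<in> A \<Longrightarrow> y \<in> A \<Longrightarrow> commutator (commutator x y) m = 0"
  shows "Lie_biderivation A (\<lambda>x y. commutator x (commutator y m))"
proof -
  have sym: "commutator x (commutator y m) = commutator y (commutator x m)"
    if "x \<in> A" "y \<in> A" for x y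
    using z[OF that] commutator_jacobi[of x y m] by simp
  have "commutator x (commutator (commutator y z) m) =
      commutator (commutator x (commutator y m)) z + commutator y (commutator x (commutator z m))"
    if A: "x \<in> A" "y \<in> A" "z \<in> A" for x y z
  proof -
    have "commutator z (commutator x (commutator y m))
        = commutator y (commutator (commutator z x) m) + commutator x (commutator z (commutator y m))"
      using A by (subst commutator_jacobi) (simp add: sym[of _ y])
    also have "\<dots> = commutator x (commutator y (commutator z m))"
      using A by (simp add: z sym[of z y])
    also have "\<dots> = commutator y (commutator x (commutator z m))"
    proof -
      have "commutator (commutator x y) (commutator z m) = commutator z (commutator (commutator x y) m)"
        using A by (intro sym) auto
      then show ?thesis using A commutator_jacobi[of x y "commutator z m"] by (simp add: z)
    qed
    finally show ?thesis
      using A by (simp add: z commutator_skew[of "commutator x _" z])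
  qed
  moreover have "commutator (commutator x z) w = commutator (commutator x w) z + commutator x (commutator z w)"
    for x z w :: 'b
    by (simp add: commutator_def algebra_simps)
  moreover have "bilinear_map_on A (\<lambda>x y. commutator x (commutator y m))"
    unfolding bilinear_map_on_def
    using m by (simp add: commutator_add_left commutator_add_right commutator_scaleC_left
        commutator_scaleC_right)
  ultimately show ?thesis
    unfolding Lie_biderivation_def by (intro conjI ballI) assumption+
qed

section \<open>Assembling the blocks, with one corner or two\<close>

context peirce_scalar
begin

lemma biadditive_form:
  assumes lb: "Lie_biderivation A \<phi>"
    and A: "x \<in> A" "y \<in> A" "x' \<in> A" "y' \<in> A"
    and form: "\<phi> x y - l *\<^sub>C commutator x y \<in> scalars" "\<phi> x y' - l *\<^sub>C commutator x y' \<in> scalars"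
      "\<phi> x' y - l *\<^sub>C commutator x' y \<in> scalars" "\<phi> x' y' - l *\<^sub>C commutator x' y' \<in> scalars"
  shows "\<phi> (x + x') (y + y') - l *\<^sub>C commutator (x + x') (y + y') \<in> scalars"
proof -
  have "\<phi> (x + x') (y + y') - l *\<^sub>C commutator (x + x') (y + y') =
      ((\<phi> x y - l *\<^sub>C commutator x y) + (\<phi> x y' - l *\<^sub>C commutator x y'))
      + ((\<phi> x' y - l *\<^sub>C commutator x' y) + (\<phi> x' y' - l *\<^sub>C commutator x' y'))"
    using A by (simp add: Lie_biderivation_add_left[OF lb] Lie_biderivation_add_right[OF lb]
        commutator_add_left commutator_add_right scaleC_add_right algebra_simps)
  also have "\<dots> \<in> scalars" using form by (intro scalars_add)
  finally show ?thesis .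
qed

text \<open>With a zero opposite corner \<open>\<phi> p p = c + m\<close>. The map
  \<open>[x, [y, m]]\<close> is itself a Lie biderivation, and subtracting it makes the value at
  \<open>(p, p)\<close> scalar.\<close>

theorem Lie_biderivation_triangular:
  assumes lb: "Lie_biderivation A \<phi>" and lower: "upper A (e - p) = {0}"
  shows "\<exists>a\<in>A. \<exists>l. \<forall>x\<in>A. \<forall>y\<in>A.
    \<phi> x y - commutator x (commutator y a) - l *\<^sub>C commutator x y \<in> scalars"
proof -
  have decomp: "\<exists>b\<in>diag A p. \<exists>u\<in>upper A p. x = b + u" if "x \<in> A" for x
    by (rule peirce_decomposition[OF that]) (use lower in auto)
  obtain c m where cm: "c \<in> diag A p" "m \<in> upper A p" "\<phi> p p = c + m"
    using decomp[OF Lie_biderivation_closed[OF lb p_closed p_closed]] by blast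
  have mA: "m \<in> A" using cm by (simp add: upper_closed)
  note corner = off_diagonal_corner[OF lb cm(3,1) _ cm(2), of 0, simplified lower, simplified]
  have zero: "commutator (commutator x y) m = 0" if xy: "x \<in> A" "y \<in> A" for x y
  proof -
    obtain b u where x: "b \<in> diag A p" "u \<in> upper A p" "x = b + u"
      using decomp[OF xy(1)] by blast
    obtain b' u' where y: "b' \<in> diag A p" "u' \<in> upper A p" "y = b' + u'"
      using decomp[OF xy(2)] by blast
    \<comment> \<open>\<open>[x, y]\<close> is \<open>[b, b']\<close> plus corner elements: the
      former commutes with \<open>m\<close> by \<open>corner(2)\<close>, the latter because
      \<open>m\<close> is in the corner.\<close>
    have "commutator b u' \<in> upper A p" "commutator u b' \<in> upper A p" using x y by auto
    then show ?thesis
      using x(1,2) y(1,2) cm(2) corner(2) unfolding x(3) y(3)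
      by (simp add: commutator_add_left commutator_add_right commutator_upper_upper)
  qed
  let ?\<psi> = "\<lambda>x y. \<phi> x y - commutator x (commutator y m)"
  have lb': "Lie_biderivation A ?\<psi>"
    by (rule Lie_biderivation_diff[OF lb extremal_Lie_biderivation[OF mA zero]]) auto
  \<comment> \<open>Only \<open>c\<close> is left, because \<open>[p, [p, m]] = m\<close>.\<close>
  have "?\<psi> p p \<in> scalars" using cm corner(1) by simp
  then obtain l where l:
    "\<And>b b'. b \<in> diag A p \<Longrightarrow> b' \<in> diag A p \<Longrightarrow> ?\<psi> b b' - l *\<^sub>C commutator b b' \<in> scalars"
    "\<And>b y. b \<in> diag A p \<Longrightarrow> y \<in> upper A p \<Longrightarrow> ?\<psi> b y = l *\<^sub>C commutator b y"
    "\<And>b y. b \<in> diag A p \<Longrightarrow> y \<in> upper A p \<Longrightarrow> ?\<psi> y b = l *\<^sub>C commutator y b"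
    "\<And>x y. x \<in> upper A p \<Longrightarrow> y \<in> upper A p \<Longrightarrow> ?\<psi> x y = 0"
    using Lie_biderivation_triangular_part[OF lb'] by blast
  have "?\<psi> x y - l *\<^sub>C commutator x y \<in> scalars" if xy: "x \<in> A" "y \<in> A" for x y
  proof -
    obtain b u where x: "b \<in> diag A p" "u \<in> upper A p" "x = b + u"
      using decomp[OF xy(1)] by blast
    obtain b' u' where y: "b' \<in> diag A p" "u' \<in> upper A p" "y = b' + u'"
      using decomp[OF xy(2)] by blast
    show ?thesis unfolding x(3) y(3)
      by (rule biadditive_form[OF lb'])
        (use x y l in \<open>auto simp: diag_closed upper_closed commutator_upper_upper complex_vector.span_zero\<close>)
  qed
  then show ?thesis using mA by blast
qed

end

text \<open>Expanding \<open>\<phi> [p, x] y\<close> and \<open>\<phi> x [p, y]\<close>, where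
  \<open>[p, x] = x\<close> and \<open>[p, y] = - y\<close>, gives two equations in which the known
  terms cancel on addition; hence \<open>2 [p, \<phi> x y] = 0\<close>.\<close>

lemma (in peirce) Lie_biderivation_upper_lower:
  assumes lb: "Lie_biderivation A \<phi>" and x: "x \<in> upper A p" and y: "y \<in> upper A (e - p)"
    and py: "\<phi> p y = l *\<^sub>C commutator p y" and xp: "\<phi> x p = l *\<^sub>C commutator x p"
  shows "\<phi> x y = l *\<^sub>C commutator x y"
proof -
  have A: "x \<in> A" "y \<in> A" using x y by (auto simp: upper_def)
  have cy: "commutator p y = - y" using y by (simp add: upper_complement commutator_def)
  have "\<phi> x y = commutator (\<phi> p y) x + commutator p (\<phi> x y)"
    using Lie_biderivation_commutator_left[OF lb, of p y x] A x by simp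
  then have 1: "\<phi> x y = l *\<^sub>C commutator x y + commutator p (\<phi> x y)"
    by (simp add: py cy commutator_minus_left commutator_scaleC_left commutator_skew[of y x])
  have "\<phi> x (- y) = - \<phi> x y"
    using Lie_biderivation_scaleC_right[OF lb, of x y "-1"] A by (simp add: scaleC_one)
  then have "- \<phi> x y = commutator (\<phi> x p) y + commutator p (\<phi> x y)"
    using Lie_biderivation_commutator_right[OF lb, of x p y] A cy by simp
  then have 2: "- \<phi> x y = - (l *\<^sub>C commutator x y) + commutator p (\<phi> x y)"
    using x by (simp add: xp commutator_minus_left commutator_scaleC_left)
  have "commutator p (\<phi> x y) + commutator p (\<phi> x y) = \<phi> x y - l *\<^sub>C commutator x y + (- \<phi> x y + l *\<^sub>C commutator x y)"
    by (subst (3) 1, subst 2) simp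
  then have "2 *\<^sub>C commutator p (\<phi> x y) = 0"
    using scaleC_add_left[of 1 1 "commutator p (\<phi> x y)"] by (simp add: scaleC_one)
  then show ?thesis using 1 by simp
qed

context peirce_scalar
begin

text \<open>\<open>e\<close> is central, so expanding \<open>\<phi> [e, z] y = 0\<close> shows that
  \<open>\<phi> e y\<close> commutes with all of \<open>A\<close>.\<close>

lemma phi_unit_scalar:
  assumes lb: "Lie_biderivation A \<phi>" and y: "y \<in> A"
  shows "\<phi> e y \<in> scalars"
proof -
  have ce: "commutator e z = 0" if "z \<in> A" for z using that by (simp add: commutator_def)
  have c: "\<phi> e y \<in> A" using Lie_biderivation_closed[OF lb] y by simp
  have z: "\<phi> 0 y = 0"
    using Lie_biderivation_scaleC_left[OF lb, of p y 0] y by simp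
  have comm: "commutator (\<phi> e y) z = 0" if A: "z \<in> A" for z
    using Lie_biderivation_commutator_left[OF lb unit_closed y A]
    by (simp add: ce[OF A] ce[OF Lie_biderivation_closed[OF lb A y]] z)
  have "commutator p (\<phi> e y) = 0" using comm[of p] commutator_skew[of p "\<phi> e y"] by simp
  then have "\<phi> e y \<in> diag A p" using c by (intro diagI)
  then show ?thesis by (rule diag_commute_upper_scalar) (rule comm, rule upper_closed)
qed

text \<open>The condition \<open>off\<close> excludes an extremal part. The one-corner analysis is
  run for \<open>p\<close> and for \<open>e - p\<close>; the common diagonal identifies the two
  constants, and pairs from opposite corners are covered by
  \<open>Lie_biderivation_upper_lower\<close>.\<close>

theorem Lie_biderivation_two_sided:
  assumes lb: "Lie_biderivation A \<phi>" and q: "peirce_scalar A e (e - p)"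
    and off: "\<And>m n. m \<in> upper A p \<Longrightarrow> n \<in> upper A (e - p) \<Longrightarrow>
      (\<And>b b'. b \<in> diag A p \<Longrightarrow> b' \<in> diag A p \<Longrightarrow> commutator (commutator b b') (m + n) = 0) \<Longrightarrow>
      m + n = 0"
  shows "\<exists>l. \<forall>x\<in>A. \<forall>y\<in>A. \<phi> x y - l *\<^sub>C commutator x y \<in> scalars"
proof -
  interpret q: peirce_scalar A e "e - p" by (rule q)
  obtain c m n where cmn: "c \<in> diag A p" "m \<in> upper A p" "n \<in> upper A (e - p)" "\<phi> p p = c + (m + n)"
    by (rule peirce_decomposition[OF Lie_biderivation_closed[OF lb p_closed p_closed]])
  note corner = off_diagonal_corner[OF lb cmn(4,1) refl cmn(2,3)]
  have "m + n = 0" using off[OF cmn(2,3) corner(2)] .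
  then have pp: "\<phi> p p \<in> scalars" using corner(1) cmn(4) by simp
  note unit = phi_unit_scalar
  have pe: "\<phi> p e \<in> scalars" using unit[OF Lie_biderivation_flip[OF lb]] by simp
  have ediff: "e - p = e + (- 1) *\<^sub>C p" by (simp add: scaleC_one)
  \<comment> \<open>Terms with \<open>e\<close> in a slot are scalar, so scalarity passes from
    \<open>p\<close> to \<open>e - p\<close>.\<close>
  have "\<phi> (e - p) (e - p) = \<phi> e (e - p) - (\<phi> p e - \<phi> p p)"
    unfolding ediff
    using Lie_biderivation_add_left[OF lb, of e "- p" "e - p"]
      Lie_biderivation_scaleC_left[OF lb, of p "e - p" "-1"]
      Lie_biderivation_add_right[OF lb, of p e "-p"]
      Lie_biderivation_scaleC_right[OF lb, of p p "-1"]
    by (simp add: scaleC_one)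
  also have "\<dots> \<in> scalars" using pp pe unit[OF lb, of "e - p"] by (intro scalars_diff) auto
  finally have qq: "\<phi> (e - p) (e - p) \<in> scalars" .
  obtain l where l:
    "\<And>b b'. b \<in> diag A p \<Longrightarrow> b' \<in> diag A p \<Longrightarrow> \<phi> b b' - l *\<^sub>C commutator b b' \<in> scalars"
    "\<And>b y. b \<in> diag A p \<Longrightarrow> y \<in> upper A p \<Longrightarrow> \<phi> b y = l *\<^sub>C commutator b y"
    "\<And>b y. b \<in> diag A p \<Longrightarrow> y \<in> upper A p \<Longrightarrow> \<phi> y b = l *\<^sub>C commutator y b"
    "\<And>x y. x \<in> upper A p \<Longrightarrow> y \<in> upper A p \<Longrightarrow> \<phi> x y = 0"
    using Lie_biderivation_triangular_part[OF lb pp] by blast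
  obtain l' where l':
    "\<And>b b'. b \<in> diag A p \<Longrightarrow> b' \<in> diag A p \<Longrightarrow> \<phi> b b' - l' *\<^sub>C commutator b b' \<in> scalars"
    "\<And>b y. b \<in> diag A p \<Longrightarrow> y \<in> upper A (e - p) \<Longrightarrow> \<phi> b y = l' *\<^sub>C commutator b y"
    "\<And>b y. b \<in> diag A p \<Longrightarrow> y \<in> upper A (e - p) \<Longrightarrow> \<phi> y b = l' *\<^sub>C commutator y b"
    "\<And>x y. x \<in> upper A (e - p) \<Longrightarrow> y \<in> upper A (e - p) \<Longrightarrow> \<phi> x y = 0"
    using q.Lie_biderivation_triangular_part[OF lb qq, unfolded diag_complement] by blast
  obtain b b' where b: "b \<in> diag A p" "b' \<in> diag A p" "commutator b b' \<notin> scalars"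
    using commutator_nonscalar by blast
  have "(\<phi> b b' - l' *\<^sub>C commutator b b') - (\<phi> b b' - l *\<^sub>C commutator b b') \<in> scalars"
    using b by (intro scalars_diff l l')
  then have "(l - l') *\<^sub>C commutator b b' \<in> scalars" by (simp add: scaleC_diff_left)
  then have "inverse (l - l') *\<^sub>C ((l - l') *\<^sub>C commutator b b') \<in> scalars" by (rule scalars_scale)
  then have ll: "l' = l" using b(3)
    by (cases "l - l' = 0") (simp_all add: scaleC_scaleC scaleC_one)
  have "\<phi> x y - l *\<^sub>C commutator x y \<in> scalars" if xy: "x \<in> A" "y \<in> A" for x y
  proof -
    obtain b u v where x: "b \<in> diag A p" "u \<in> upper A p" "v \<in> upper A (e - p)" "x = b + (u + v)"
      by (rule peirce_decomposition[OF xy(1)])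
    obtain b' u' v' where y: "b' \<in> diag A p" "u' \<in> upper A p" "v' \<in> upper A (e - p)" "y = b' + (u' + v')"
      by (rule peirce_decomposition[OF xy(2)])
    have mem: "b \<in> A" "u \<in> A" "v \<in> A" "b' \<in> A" "u' \<in> A" "v' \<in> A"
      using x y by (auto simp: diag_closed upper_closed q.upper_closed)
    have uv': "\<phi> u v' = l *\<^sub>C commutator u v'"
      by (rule Lie_biderivation_upper_lower[OF lb]) (use x y l l' ll in auto)
    \<comment> \<open>For the flipped map the constant is \<open>- l\<close>.\<close>
    have "\<phi> v u' = - l *\<^sub>C commutator u' v"
      by (rule Lie_biderivation_upper_lower[OF Lie_biderivation_flip[OF lb]])
        (use x y l l' ll in \<open>auto simp: commutator_skew[of _ p]\<close>)
    then have vu': "\<phi> v u' = l *\<^sub>C commutator v u'" by (simp add: commutator_skew[of v])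
    note facts = l l'[unfolded ll] uv' vu' commutator_upper_upper q.commutator_upper_upper
      complex_vector.span_zero
    have diag_part: "\<phi> b z - l *\<^sub>C commutator b z \<in> scalars" "\<phi> z b - l *\<^sub>C commutator z b \<in> scalars"
      if b: "b \<in> diag A p" and z: "z = u + v" "u \<in> upper A p" "v \<in> upper A (e - p)" for b z u v
      using b z(2,3) unfolding z(1)
      by (auto simp: facts upper_closed q.upper_closed diag_closed Lie_biderivation_add_left[OF lb]
          Lie_biderivation_add_right[OF lb] commutator_add_left commutator_add_right scaleC_add_right)
    have off_part: "\<phi> (u + v) (u' + v') - l *\<^sub>C commutator (u + v) (u' + v') \<in> scalars"
      by (rule biadditive_form[OF lb]) (use x y mem facts in auto)
    show ?thesis unfolding x(4) y(4)
      by (rule biadditive_form[OF lb])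
        (use x y mem l(1) off_part diag_part[OF _ refl] in auto)
  qed
  then show ?thesis by blast
qed

end

section \<open>Projections and rank-one operators\<close>

lemma cinner_add_right: "cinner x (y + z) = cinner x y + cinner x (z::'a::complex_hilbert_space)"
  by (subst (1 2 3) cinner_commute) (simp add: cinner_add_left)

lemma cinner_scaleC_right: "cinner x (c *\<^sub>C y) = cnj c * cinner x (y::'a::complex_hilbert_space)"
  by (subst (1 2) cinner_commute) (simp add: cinner_scaleC_left)

lemma cinner_zero_left [simp]: "cinner 0 (x::'a::complex_hilbert_space) = 0"
  using cinner_add_left[of 0 0 x] by simp

lemma cinner_zero_right [simp]: "cinner (x::'a::complex_hilbert_space) 0 = 0"
  using cinner_add_right[of x 0 0] by simp

lemma cinner_minus_left: "cinner (- x) (y::'a::complex_hilbert_space) = - cinner x y"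
  using cinner_add_left[of "- x" x y] by (simp add: add_eq_0_iff)

lemma cinner_minus_right: "cinner x (- y::'a::complex_hilbert_space) = - cinner x y"
  using cinner_add_right[of x "- y" y] by (simp add: add_eq_0_iff)

lemma cinner_diff_left: "cinner (x - y) (z::'a::complex_hilbert_space) = cinner x z - cinner y z"
  using cinner_add_left[of x "- y" z] by (simp add: cinner_minus_left)

lemma cinner_diff_right: "cinner x (y - z::'a::complex_hilbert_space) = cinner x y - cinner x z"
  using cinner_add_right[of x y "- z"] by (simp add: cinner_minus_right)

lemmas cinner_simps = cinner_add_left cinner_add_right cinner_diff_left cinner_diff_right
  cinner_scaleC_left cinner_scaleC_right

lemma cinner_eq_zero_commute: "cinner x y = 0 \<longleftrightarrow> cinner y (x::'a::complex_hilbert_space) = 0"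
  using cinner_commute[of x y] cinner_commute[of y x] by (metis complex_cnj_zero)

lemma cinner_self: "cinner x (x::'a::complex_hilbert_space) = complex_of_real ((norm x)\<^sup>2)"
proof -
  have "Im (cinner x x) = 0"
    using arg_cong[OF cinner_commute[of x x], of Im] by simp
  then show ?thesis
    by (simp add: complex_eq_iff norm_eq_sqrt_cinner cinner_ge_zero)
qed

lemma norm_power2_cinner: "(norm x)\<^sup>2 = Re (cinner x (x::'a::complex_hilbert_space))"
  by (simp add: cinner_self)

text \<open>Pythagoras for the projection of \<open>x\<close> on the line of \<open>y\<close>.
  Nonnegativity of the left side yields Cauchy-Schwarz, and the explicit gain shows that a nearest
  point is an orthogonal projection.\<close>

lemma norm_diff_projection:
  fixes x y :: "'a::complex_hilbert_space"
  assumes "y \<noteq> 0"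
  shows "(norm (x - (cinner x y / cinner y y) *\<^sub>C y))\<^sup>2 = (norm x)\<^sup>2 - (cmod (cinner x y))\<^sup>2 / (norm y)\<^sup>2"
proof -
  let ?t = "cinner x y / cinner y y" and ?n = "complex_of_real ((norm y)\<^sup>2)"
  have n: "?n \<noteq> 0" using assms by simp
  have "cinner (x - ?t *\<^sub>C y) (x - ?t *\<^sub>C y)
      = cinner x x - cnj ?t * cinner x y - ?t * cinner y x + ?t * cnj ?t * cinner y y"
    by (simp add: cinner_simps algebra_simps)
  also have "\<dots> = cinner x x - cinner x y * cnj (cinner x y) / ?n"
    using n cinner_commute[of y x] by (simp add: cinner_self field_simps)
  also have "\<dots> = complex_of_real ((norm x)\<^sup>2 - (cmod (cinner x y))\<^sup>2 / (norm y)\<^sup>2)"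
    unfolding cinner_self complex_norm_square[symmetric] by simp
  finally show ?thesis by (metis cinner_self of_real_eq_iff)
qed

lemma cinner_Cauchy_Schwarz: "cmod (cinner x y) \<le> norm x * norm (y::'a::complex_hilbert_space)"
proof (cases "y = 0")
  case False
  have "0 \<le> (norm x)\<^sup>2 - (cmod (cinner x y))\<^sup>2 / (norm y)\<^sup>2"
    by (metis norm_diff_projection[OF False] zero_le_power2)
  then have "(cmod (cinner x y))\<^sup>2 \<le> (norm x * norm y)\<^sup>2"
    using False by (simp add: field_simps power_mult_distrib)
  then show ?thesis by (rule power2_le_imp_le) simp
qed simp

lemma norm_scaleC: "norm (c *\<^sub>C x) = cmod c * norm (x::'a::complex_hilbert_space)"
proof -
  have "cinner (c *\<^sub>C x) (c *\<^sub>C x) = c * cnj c * complex_of_real ((norm x)\<^sup>2)"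
    by (subst cinner_scaleC_left, subst cinner_scaleC_right) (simp only: cinner_self mult.assoc)
  also have "\<dots> = complex_of_real ((cmod c * norm x)\<^sup>2)"
    unfolding complex_norm_square[symmetric] by (simp add: power_mult_distrib)
  finally have "(norm (c *\<^sub>C x))\<^sup>2 = (cmod c * norm x)\<^sup>2" by (simp only: cinner_self of_real_eq_iff)
  then show ?thesis by (simp add: power2_eq_iff_nonneg)
qed

section \<open>Nearest points and orthogonal projections\<close>

lemma parallelogram_law:
  fixes x y :: "'a::complex_hilbert_space"
  shows "(norm (x + y))\<^sup>2 + (norm (x - y))\<^sup>2 = 2 * (norm x)\<^sup>2 + 2 * (norm y)\<^sup>2"
  by (simp add: norm_power2_cinner cinner_simps)

lemma subspace_scaleR:
  fixes N :: "'a::complex_hilbert_space set"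
  assumes "complex_vector.subspace N" "x \<in> N"
  shows "r *\<^sub>R x \<in> N"
  using assms by (simp add: scaleR_scaleC complex_vector.subspace_scale)

lemma closest_point_subspace:
  fixes N :: "'a::complex_hilbert_space set"
  assumes sub: "complex_vector.subspace N" and cl: "closed N"
  shows "\<exists>y\<in>N. \<forall>z\<in>N. norm (x - y) \<le> norm (x - z)"
proof -
  have N0: "0 \<in> N" using sub by (rule complex_vector.subspace_0)
  define d where "d = (INF z\<in>N. (norm (x - z))\<^sup>2)"
  have bdd: "bdd_below ((\<lambda>z. (norm (x - z))\<^sup>2) ` N)" by (rule bdd_belowI[of _ 0]) auto
  have d_le: "d \<le> (norm (x - z))\<^sup>2" if "z \<in> N" for z
    unfolding d_def by (rule cINF_lower[OF bdd that])
  have "\<exists>z\<in>N. (norm (x - z))\<^sup>2 < d + inverse (real (Suc k))" for k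
  proof -
    have "d < d + inverse (real (Suc k))" by simp
    then show ?thesis
      unfolding d_def using N0 bdd by (subst (asm) (1) cINF_less_iff) auto
  qed
  then obtain f where f: "\<And>k. f k \<in> N" "\<And>k. (norm (x - f k))\<^sup>2 < d + inverse (real (Suc k))"
    by metis
  have dist2: "(norm (f j - f k))\<^sup>2 \<le> 2 * (inverse (real (Suc j)) + inverse (real (Suc k)))" for j k
  proof -
    \<comment> \<open>The midpoint lies in \<open>N\<close>, so its squared distance to
      \<open>x\<close> is at least \<open>d\<close>. The parallelogram law then bounds the distance
      of \<open>f j\<close> and \<open>f k\<close>, which makes the minimizing sequence
      Cauchy.\<close>
    let ?z = "(1/2) *\<^sub>R (f j + f k)"
    have zN: "?z \<in> N" using sub f(1) by (intro subspace_scaleR complex_vector.subspace_add)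
    have eq: "(x - f k) + (x - f j) = 2 *\<^sub>R (x - ?z)" "(x - f k) - (x - f j) = f j - f k"
      by (simp_all add: scaleR_right_diff_distrib scaleR_2)
    have "(norm (2 *\<^sub>R (x - ?z)))\<^sup>2 + (norm (f j - f k))\<^sup>2 = 2 * (norm (x - f k))\<^sup>2 + 2 * (norm (x - f j))\<^sup>2"
      using parallelogram_law[of "x - f k" "x - f j"] unfolding eq .
    moreover have "(norm (2 *\<^sub>R (x - ?z)))\<^sup>2 = 4 * (norm (x - ?z))\<^sup>2"
      unfolding norm_scaleR by (simp add: power_mult_distrib)
    moreover have "b \<le> 2 * (r + s)" if "t + b = 2 * c + 2 * e" "t = 4 * z" "d \<le> z" "e < d + r" "c < d + s"
      for b c e r s t z :: real using that by argo
    ultimately show ?thesis using d_le[OF zN] f(2)[of j] f(2)[of k] by blast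
  qed
  have "Cauchy f"
  proof (rule CauchyI)
    fix e :: real assume e: "0 < e"
    then have "0 < e\<^sup>2 / 4" by simp
    then obtain M where M: "inverse (real (Suc M)) < e\<^sup>2 / 4" using reals_Archimedean by blast
    show "\<exists>M. \<forall>m\<ge>M. \<forall>n\<ge>M. norm (f m - f n) < e"
    proof (intro exI allI impI)
      fix m n assume mn: "M \<le> m" "M \<le> n"
      have "inverse (real (Suc m)) \<le> inverse (real (Suc M))" "inverse (real (Suc n)) \<le> inverse (real (Suc M))"
        using mn by (auto intro!: le_imp_inverse_le)
      then have "(norm (f m - f n))\<^sup>2 < e\<^sup>2" using dist2[of m n] M by argo
      then show "norm (f m - f n) < e" using e by (simp add: power2_less_imp_less)
    qed
  qed
  then obtain y where y: "f \<longlonglongrightarrow> y" by (auto simp: Cauchy_convergent_iff convergent_def)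
  have yN: "y \<in> N" using closed_sequentially[OF cl _ y] f(1) by blast
  have "(\<lambda>k. (norm (x - f k))\<^sup>2) \<longlonglongrightarrow> (norm (x - y))\<^sup>2" by (intro tendsto_intros y)
  moreover have "(\<lambda>k. d + inverse (real (Suc k))) \<longlonglongrightarrow> d + 0"
    by (intro tendsto_intros LIMSEQ_inverse_real_of_nat)
  ultimately have "(norm (x - y))\<^sup>2 \<le> d + 0"
    by (rule LIMSEQ_le) (use f(2) less_imp_le in blast)
  then have "(norm (x - y))\<^sup>2 \<le> (norm (x - z))\<^sup>2" if "z \<in> N" for z
    using d_le[OF that] by argo
  then have "norm (x - y) \<le> norm (x - z)" if "z \<in> N" for z
    using that by (blast intro: power2_le_imp_le norm_ge_zero)
  then show ?thesis using yN by blast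
qed

lemma orthogonal_projection_exists:
  fixes N :: "'a::complex_hilbert_space set"
  assumes sub: "complex_vector.subspace N" and cl: "closed N"
  shows "\<exists>y\<in>N. \<forall>n\<in>N. cinner (x - y) n = 0"
proof -
  obtain y where y: "y \<in> N" "\<And>z. z \<in> N \<Longrightarrow> norm (x - y) \<le> norm (x - z)"
    using closest_point_subspace[OF assms] by blast
  have "cinner (x - y) n = 0" if n: "n \<in> N" for n
  proof (cases "n = 0")
    case False
    let ?t = "cinner (x - y) n / cinner n n"
    \<comment> \<open>Moving the nearest point by the projection of \<open>x - y\<close> on
      \<open>n\<close> would shorten the distance unless that projection is zero.\<close>
    have "y + ?t *\<^sub>C n \<in> N"
      using sub y(1) n by (intro complex_vector.subspace_add complex_vector.subspace_scale)
    from y(2)[OF this] have "(norm (x - y))\<^sup>2 \<le> (norm (x - y - ?t *\<^sub>C n))\<^sup>2"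
      by (simp add: diff_diff_eq)
    then have "(cmod (cinner (x - y) n))\<^sup>2 / (norm n)\<^sup>2 \<le> 0"
      unfolding norm_diff_projection[OF False] by simp
    then have "(cmod (cinner (x - y) n))\<^sup>2 \<le> 0"
      using False by (simp add: divide_le_0_iff)
    then show ?thesis by simp
  qed simp
  then show ?thesis using y(1) by blast
qed

section \<open>Evaluation of operators, rank-one operators and projections\<close>

lemma bounded_op_eqI: "(\<And>x. op_apply S x = op_apply T x) \<Longrightarrow> S = T"
  by (metis op_apply_inject ext)

lemma op_apply_linear [simp]:
  fixes T :: "'a::complex_hilbert_space bounded_op"
  shows "op_apply T (x + y) = op_apply T x + op_apply T y"
    and "op_apply T (x - y) = op_apply T x - op_apply T y"
    and "op_apply T (c *\<^sub>C x) = c *\<^sub>C op_apply T x"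
    and "op_apply T 0 = 0"
  using op_apply[of T] by (auto simp: linear_simps)

lemma op_apply_bounded_linear: "bounded_linear (op_apply T)"
  using op_apply[of T] by simp

lemma op_apply_simps [simp]:
  "op_apply (S + T) x = op_apply S x + op_apply T x"
  "op_apply (S - T) x = op_apply S x - op_apply T x"
  "op_apply (S * T) x = op_apply S (op_apply T x)"
  "op_apply (c *\<^sub>C S) x = c *\<^sub>C op_apply S x"
  "op_apply 0 x = 0"
  by (transfer, simp)+

lift_definition id_op :: "'a::complex_hilbert_space bounded_op" is "\<lambda>x. x"
  by simp

lemma op_apply_id [simp]: "op_apply id_op x = x"
  by transfer simp

lift_definition rank_one :: "'a::complex_hilbert_space \<Rightarrow> 'a \<Rightarrow> 'a bounded_op"
  is "\<lambda>a b x. cinner x b *\<^sub>C a"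
proof -
  fix a b :: 'a
  have "bounded_linear (\<lambda>x. cinner x b *\<^sub>C a)"
  proof (rule bounded_linear_intro)
    fix x :: 'a
    have "norm (cinner x b *\<^sub>C a) \<le> norm x * norm b * norm a"
      unfolding norm_scaleC by (intro mult_right_mono cinner_Cauchy_Schwarz) simp
    then show "norm (cinner x b *\<^sub>C a) \<le> norm x * (norm b * norm a)" by (simp add: mult.assoc)
  qed (simp_all add: cinner_simps scaleC_add_left scaleR_scaleC scaleC_scaleC)
  then show "bounded_linear (\<lambda>x. cinner x b *\<^sub>C a) \<and>
      (\<forall>c x. cinner (c *\<^sub>C x) b *\<^sub>C a = c *\<^sub>C cinner x b *\<^sub>C a)"
    by (simp add: cinner_simps scaleC_scaleC)
qed

lemma op_apply_rank_one [simp]: "op_apply (rank_one a b) x = cinner x b *\<^sub>C a"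
  by transfer simp

text \<open>Phrased through the values of \<open>P\<close>, which avoids adjoints; self-adjointness
  and idempotence follow.\<close>

definition is_projection :: "'a::complex_hilbert_space set \<Rightarrow> 'a bounded_op \<Rightarrow> bool" where
  "is_projection N P \<longleftrightarrow> complex_vector.subspace N \<and>
     (\<forall>x. op_apply P x \<in> N \<and> (\<forall>n\<in>N. cinner (x - op_apply P x) n = 0))"

text \<open>The orthogonal decomposition of a vector is unique, which makes the chosen map linear;
  Cauchy-Schwarz bounds its norm by one.\<close>

lemma projection_exists:
  fixes N :: "'a::complex_hilbert_space set"
  assumes sub: "complex_vector.subspace N" and cl: "closed N"
  shows "\<exists>P. is_projection N P"
proof -
  obtain f where f: "\<And>x. f x \<in> N" "\<And>x n. n \<in> N \<Longrightarrow> cinner (x - f x) n = 0"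
    using orthogonal_projection_exists[OF assms] by metis
  have unique: "f x = y" if y: "y \<in> N" "\<And>n. n \<in> N \<Longrightarrow> cinner (x - y) n = 0" for x y
  proof -
    have "f x - y \<in> N" using sub f(1) y(1) by (rule complex_vector.subspace_diff)
    then have "cinner (x - y) (f x - y) - cinner (x - f x) (f x - y) = 0" using y(2) f(2) by simp
    then have "cinner (f x - y) (f x - y) = 0" by (simp add: cinner_diff_left)
    then show ?thesis by (simp add: cinner_eq_zero_iff)
  qed
  have add: "f (x + y) = f x + f y" for x y
  proof (rule unique)
    show "f x + f y \<in> N" using sub f(1) by (intro complex_vector.subspace_add)
    show "cinner (x + y - (f x + f y)) n = 0" if "n \<in> N" for n
      using f(2)[OF that, of x] f(2)[OF that, of y] by (simp add: cinner_simps)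
  qed
  have scale: "f (c *\<^sub>C x) = c *\<^sub>C f x" for c x
  proof (rule unique)
    show "c *\<^sub>C f x \<in> N" using sub f(1) by (intro complex_vector.subspace_scale)
    show "cinner (c *\<^sub>C x - c *\<^sub>C f x) n = 0" if "n \<in> N" for n
      using f(2)[OF that, of x] by (simp add: cinner_simps)
  qed
  have bound: "norm (f x) \<le> norm x * 1" for x
  proof -
    have "cinner (f x) (f x) = cinner x (f x)" using f(2)[OF f(1), of x x] by (simp add: cinner_diff_left)
    then have "cmod (complex_of_real ((norm (f x))\<^sup>2)) \<le> norm x * norm (f x)"
      using cinner_Cauchy_Schwarz[of x "f x"] by (metis cinner_self)
    then have "norm (f x) * norm (f x) \<le> norm x * norm (f x)"
      unfolding norm_of_real by (simp add: power2_eq_square)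
    then show ?thesis by (cases "f x = 0") auto
  qed
  have "bounded_linear f"
    by (rule bounded_linear_intro[OF add _ bound]) (simp add: scaleR_scaleC scale)
  then have "op_apply (Bounded_Op f) = f" by (simp add: Bounded_Op_inverse scale)
  then show ?thesis using sub f unfolding is_projection_def by metis
qed

text \<open>Otherwise Gram-Schmidt applied to \<open>u, v\<close> yields a spanning pair, since
  every residual is orthogonal to \<open>u\<close> and \<open>v\<close>. Exhibiting a finite
  spanning set is what makes the dimension hypothesis usable.\<close>

lemma complex_dim_ge_3_orthogonal:
  fixes u v :: "'a::complex_hilbert_space"
  assumes dim: "complex_dim_ge TYPE('a) 3"
  shows "\<exists>w. w \<noteq> 0 \<and> cinner w u = 0 \<and> cinner w v = 0"
proof (rule ccontr)
  assume neg: "\<not> ?thesis"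
  \<comment> \<open>For \<open>u = 0\<close> the quotient is \<open>0\<close> by the convention for
    division, so that \<open>v' = v\<close>.\<close>
  define v' where "v' = v - (cinner v u / cinner u u) *\<^sub>C u"
  have v'u: "cinner v' u = 0"
    by (cases "u = 0") (simp_all add: v'_def cinner_simps cinner_eq_zero_iff)
  have uv': "cinner u v' = 0" using v'u cinner_eq_zero_commute by blast
  have "h \<in> complex_vector.span {u, v'}" for h
  proof -
    let ?s = "cinner h u / cinner u u" and ?t = "cinner h v' / cinner v' v'"
    let ?w = "h - ?s *\<^sub>C u - ?t *\<^sub>C v'"
    have wu: "cinner ?w u = 0"
      by (cases "u = 0") (simp_all add: cinner_simps v'u cinner_eq_zero_iff)
    have wv': "cinner ?w v' = 0"
      by (cases "v' = 0") (simp_all add: cinner_simps uv' cinner_eq_zero_iff)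
    have "v = v' + (cinner v u / cinner u u) *\<^sub>C u" by (simp add: v'_def)
    then have "cinner ?w v = 0"
      using wu wv' cinner_add_right[of ?w v'] cinner_scaleC_right[of ?w _ u] by (metis add_0 mult_zero_right)
    then have "?w = 0" using neg wu by blast
    then have "h = ?s *\<^sub>C u + ?t *\<^sub>C v'" by (simp add: algebra_simps)
    also have "\<dots> \<in> complex_vector.span {u, v'}"
      by (intro complex_vector.span_add complex_vector.span_scale complex_vector.span_base) auto
    finally show ?thesis .
  qed
  then have sp: "complex_vector.span {u, v'} = UNIV" by blast
  then have "3 \<le> complex_vector.dim (UNIV :: 'a set)"
    using dim unfolding complex_dim_ge_def by (metis finite.emptyI finite.insertI)
  also have "\<dots> \<le> card {u, v'}"
    by (rule complex_vector.dim_le_card) (auto simp: sp)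
  also have "\<dots> \<le> 2" by (simp add: card_insert_if)
  finally show False by simp
qed

section \<open>Subspaces comparable with a nest\<close>

lemma is_projection_fixed:
  assumes P: "is_projection N P" and x: "x \<in> N"
  shows "op_apply P x = x"
proof -
  have "x - op_apply P x \<in> N"
    using P x unfolding is_projection_def by (blast intro: complex_vector.subspace_diff)
  then have "cinner (x - op_apply P x) (x - op_apply P x) = 0"
    using P unfolding is_projection_def by blast
  then show ?thesis by (simp add: cinner_eq_zero_iff)
qed

lemma is_projection_cinner:
  assumes P: "is_projection N P"
  shows "cinner (op_apply P x) y = cinner x (op_apply P y)"
proof -
  have "cinner (x - op_apply P x) (op_apply P y) = 0" "cinner (y - op_apply P y) (op_apply P x) = 0"
    using P unfolding is_projection_def by blast+
  then have "cinner x (op_apply P y) = cinner (op_apply P x) (op_apply P y)"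
    "cinner (op_apply P x) (y - op_apply P y) = 0"
    using cinner_eq_zero_commute[of "op_apply P x"] by (simp_all add: cinner_diff_left)
  then show ?thesis by (simp add: cinner_diff_right)
qed

lemma is_projection_complement:
  assumes P: "is_projection N P"
  shows "is_projection {x. \<forall>n\<in>N. cinner x n = 0} (id_op - P)"
  unfolding is_projection_def
proof (intro conjI allI ballI)
  show "complex_vector.subspace {x. \<forall>n\<in>N. cinner x n = 0}"
    by (auto simp: complex_vector.subspace_def cinner_simps)
  show "op_apply (id_op - P) x \<in> {x. \<forall>n\<in>N. cinner x n = 0}" for x
    using P by (simp add: is_projection_def)
  show "cinner (x - op_apply (id_op - P) x) n = 0" if "n \<in> {x. \<forall>n\<in>N. cinner x n = 0}" for x n
    using P that by (simp add: is_projection_def cinner_eq_zero_commute[of "op_apply P x"])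
qed

text \<open>The rank-one operator \<open>x \<mapsto> \<langle>x, b\<rangle> a\<close> leaves \<open>M\<close> invariant if \<open>a \<in> M\<close> or \<open>b \<bottom> M\<close>.\<close>

definition rank_one_admissible :: "'a::complex_hilbert_space set set \<Rightarrow> 'a \<Rightarrow> 'a \<Rightarrow> bool" where
  "rank_one_admissible \<N> a b \<longleftrightarrow> (\<forall>M\<in>\<N>. a \<in> M \<or> (\<forall>m\<in>M. cinner m b = 0))"

text \<open>Suppose \<open>(a, b')\<close> fails at \<open>M\<close> and \<open>(a', b)\<close> at
  \<open>M'\<close>. Then \<open>b \<bottom> M\<close> and \<open>a' \<in> M\<close> by
  admissibility of the given pairs. The first is contradictory if \<open>M' \<subseteq> M\<close>,
  the second if \<open>M \<subseteq> M'\<close>.\<close>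

lemma rank_one_admissible_exchange:
  assumes chain: "\<forall>M\<in>\<N>. \<forall>N\<in>\<N>. M \<subseteq> N \<or> N \<subseteq> M"
    and "rank_one_admissible \<N> a b" "rank_one_admissible \<N> a' b'"
  shows "rank_one_admissible \<N> a b' \<or> rank_one_admissible \<N> a' b"
  using assms unfolding rank_one_admissible_def by (meson subsetD)

text \<open>\<open>N\<close> may lie outside the nest. This admits a line and its orthogonal
  complement when the nest is trivial, besides a proper nonzero member of a nontrivial nest.\<close>

locale comparable_subspace =
  fixes \<N> :: "'a::complex_hilbert_space set set" and N :: "'a set" and P :: "'a bounded_op"
  assumes nest: "nest \<N>"
    and comparable: "\<And>M. M \<in> \<N> \<Longrightarrow> M \<subseteq> N \<or> N \<subseteq> M"
    and proj: "is_projection N P"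
    and nonzero: "N \<noteq> {0}"
    and proper: "N \<noteq> UNIV"
    and dim3: "\<And>u v :: 'a. \<exists>w. w \<noteq> 0 \<and> cinner w u = 0 \<and> cinner w v = 0"
begin

abbreviation "adm \<equiv> rank_one_admissible \<N>"

definition "Nperp = {x. \<forall>n\<in>N. cinner x n = 0}"

lemma nest_subspace: "M \<in> \<N> \<Longrightarrow> complex_vector.subspace M"
  and nest_closed: "M \<in> \<N> \<Longrightarrow> closed M"
  and nest_chain: "\<forall>M\<in>\<N>. \<forall>N\<in>\<N>. M \<subseteq> N \<or> N \<subseteq> M"
  using nest by (auto simp: nest_def)

lemma subspace_N: "complex_vector.subspace N"
  using proj by (simp add: is_projection_def)

lemma subspace_Nperp: "complex_vector.subspace Nperp"
  by (auto simp: complex_vector.subspace_def cinner_simps Nperp_def)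

lemma P_N [simp]: "x \<in> N \<Longrightarrow> op_apply P x = x"
  by (rule is_projection_fixed[OF proj])

lemma P_in [simp]: "op_apply P x \<in> N"
  using proj by (simp add: is_projection_def)

lemma P_compl [simp]: "x - op_apply P x \<in> Nperp"
  using proj by (simp add: is_projection_def Nperp_def)

lemma P_cinner: "cinner (op_apply P x) y = cinner x (op_apply P y)"
  by (rule is_projection_cinner[OF proj])

lemma cinner_N_Nperp: "x \<in> N \<Longrightarrow> y \<in> Nperp \<Longrightarrow> cinner x y = 0" "x \<in> N \<Longrightarrow> y \<in> Nperp \<Longrightarrow> cinner y x = 0"
  by (auto simp: Nperp_def cinner_eq_zero_commute[of x])

lemma P_Nperp [simp]: "x \<in> Nperp \<Longrightarrow> op_apply P x = 0"
  using P_cinner[of x "op_apply P x"] cinner_N_Nperp[of "op_apply P x" x] cinner_eq_zero_iff[of "op_apply P x"]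
  by simp

lemma nest_algebra_apply: "T \<in> nest_algebra \<N> \<Longrightarrow> M \<in> \<N> \<Longrightarrow> x \<in> M \<Longrightarrow> op_apply T x \<in> M"
  by (auto simp: nest_algebra_def)

lemma nest_algebraI: "(\<And>M x. M \<in> \<N> \<Longrightarrow> x \<in> M \<Longrightarrow> op_apply T x \<in> M) \<Longrightarrow> T \<in> nest_algebra \<N>"
  by (auto simp: nest_algebra_def)

sublocale peirce "nest_algebra \<N>" id_op P
proof
  show "x + y \<in> nest_algebra \<N>" if "x \<in> nest_algebra \<N>" "y \<in> nest_algebra \<N>" for x y
    using that
    by (intro nest_algebraI) (simp add: nest_algebra_apply complex_vector.subspace_add nest_subspace)
  show "x * y \<in> nest_algebra \<N>" if "x \<in> nest_algebra \<N>" "y \<in> nest_algebra \<N>" for x y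
    using that by (intro nest_algebraI) (auto simp: nest_algebra_apply)
  show "c *\<^sub>C x \<in> nest_algebra \<N>" if "x \<in> nest_algebra \<N>" for x c
    using that
    by (intro nest_algebraI) (simp add: nest_algebra_apply complex_vector.subspace_scale nest_subspace)
  show "id_op \<in> nest_algebra \<N>" by (intro nest_algebraI) simp
  show "id_op * x = x" "x * id_op = x" for x :: "'a bounded_op"
    by (auto intro!: bounded_op_eqI)
  show "P \<in> nest_algebra \<N>"
  proof (rule nest_algebraI)
    fix M x assume "M \<in> \<N>" "x \<in> M"
    \<comment> \<open>If \<open>M\<close> is inside \<open>N\<close>, then \<open>P\<close> is the
      identity on \<open>M\<close>; otherwise \<open>M\<close> contains the range of
      \<open>P\<close>.\<close>
    then show "op_apply P x \<in> M"
      using comparable[of M] P_in[of x] P_N[of x] by fastforce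
  qed
  show "P * P = P" by (auto intro!: bounded_op_eqI)
qed

lemma rank_one_in: "adm a b \<Longrightarrow> rank_one a b \<in> nest_algebra \<N>"
  using nest_subspace unfolding rank_one_admissible_def
  by (intro nest_algebraI) (force intro: complex_vector.subspace_scale simp: complex_vector.subspace_0)

lemma adm_N_Nperp:
  assumes "a \<in> N" "b \<in> Nperp"
  shows "adm a b"
  unfolding rank_one_admissible_def
proof
  fix M assume "M \<in> \<N>"
  then show "a \<in> M \<or> (\<forall>m\<in>M. cinner m b = 0)"
    using comparable[of M] assms by (auto simp: cinner_N_Nperp)
qed

lemma rank_one_upper:
  assumes "a \<in> N" "b \<in> Nperp"
  shows "rank_one a b \<in> upper (nest_algebra \<N>) P"
  using rank_one_in[OF adm_N_Nperp[OF assms]] assms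
  by (auto simp: upper_def cinner_N_Nperp intro!: bounded_op_eqI)

lemma upper_apply:
  assumes "y \<in> upper (nest_algebra \<N>) P"
  shows "op_apply y x \<in> N" "x \<in> N \<Longrightarrow> op_apply y x = 0"
proof -
  have "P * y = y" "y * P = 0" using assms by (auto simp: upper_def)
  then have "op_apply P (op_apply y x) = op_apply y x" "op_apply y (op_apply P x) = 0"
    by (metis op_apply_simps(3), metis op_apply_simps(3,5))
  then show "op_apply y x \<in> N" "x \<in> N \<Longrightarrow> op_apply y x = 0" by (metis P_in, simp)
qed

lemma rank_one_diag_N:
  assumes "adm a b" "a \<in> N" "b \<in> N"
  shows "rank_one a b \<in> diag (nest_algebra \<N>) P"
  using rank_one_in[OF assms(1)] assms(2,3)
  by (auto simp: diag_def P_cinner intro!: bounded_op_eqI)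

lemma rank_one_diag_Nperp:
  assumes "adm a b" "a \<in> Nperp" "b \<in> Nperp"
  shows "rank_one a b \<in> diag (nest_algebra \<N>) P"
  using rank_one_in[OF assms(1)] assms(2,3)
  by (auto simp: diag_def P_cinner intro!: bounded_op_eqI)

section \<open>Separation of vectors by admissible pairs\<close>

lemma nest_projection:
  assumes "M \<in> \<N>"
  obtains Q where "is_projection M Q"
  using projection_exists[OF nest_subspace[OF assms] nest_closed[OF assms]] by blast

text \<open>If \<open>v\<close> lies in every nonzero member, \<open>(v, v)\<close> is admissible.
  Otherwise a nonzero member \<open>M\<close> misses \<open>v\<close>; take \<open>a\<close> in
  \<open>M\<close> and for \<open>b\<close> the part of \<open>v\<close> orthogonal to
  \<open>M\<close>: members above \<open>M\<close> contain \<open>a\<close>, those below are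
  orthogonal to \<open>b\<close>.\<close>

lemma adm_separates_N:
  assumes v: "v \<in> N" "v \<noteq> 0"
  obtains a b where "adm a b" "a \<in> N" "a \<noteq> 0" "b \<in> N" "cinner v b \<noteq> 0"
proof (cases "\<exists>M\<in>\<N>. v \<notin> M \<and> M \<noteq> {0}")
  case True
  then obtain M where M: "M \<in> \<N>" "v \<notin> M" "M \<noteq> {0}" by blast
  then have MN: "M \<subseteq> N" using comparable v by blast
  obtain Q where Q: "is_projection M Q" by (rule nest_projection[OF M(1)])
  have "0 \<in> M" using nest_subspace[OF M(1)] by (rule complex_vector.subspace_0)
  then obtain a where a: "a \<in> M" "a \<noteq> 0" using M(3) by blast
  let ?b = "v - op_apply Q v"
  have Qv: "op_apply Q v \<in> M" and orth: "\<And>m. m \<in> M \<Longrightarrow> cinner ?b m = 0"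
    using Q by (auto simp: is_projection_def)
  have "?b \<noteq> 0" using Qv M(2) by auto
  have "cinner (op_apply Q v) ?b = 0" using orth[OF Qv] cinner_eq_zero_commute by blast
  then have "cinner v ?b = cinner ?b ?b" by (simp add: cinner_diff_left)
  then have "cinner v ?b \<noteq> 0" using \<open>?b \<noteq> 0\<close> by (simp add: cinner_eq_zero_iff)
  moreover have "adm a ?b"
    unfolding rank_one_admissible_def
  proof
    fix L assume "L \<in> \<N>"
    then consider "M \<subseteq> L" | "L \<subseteq> M" using nest_chain M(1) by blast
    then show "a \<in> L \<or> (\<forall>m\<in>L. cinner m ?b = 0)"
      using a orth cinner_eq_zero_commute by cases blast+
  qed
  moreover have "?b \<in> N" using subspace_N v Qv MN by (blast intro: complex_vector.subspace_diff)
  ultimately show ?thesis using that a MN by blast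
next
  case False
  then have "adm v v" by (auto simp: rank_one_admissible_def)
  then show ?thesis using that[of v v] v by (simp add: cinner_eq_zero_iff)
qed

text \<open>Dual to \<open>adm_separates_N\<close>. If \<open>v\<close> is orthogonal to every
  proper member, \<open>(v, v)\<close> is admissible. Otherwise a proper member \<open>M\<close> not
  orthogonal to \<open>v\<close> supplies \<open>a\<close> as the projection of \<open>v\<close> to
  \<open>M\<close>, and \<open>b\<close> is orthogonal to \<open>M\<close>.\<close>

lemma adm_separates_Nperp:
  assumes v: "v \<in> Nperp" "v \<noteq> 0"
  obtains a b where "adm a b" "a \<in> Nperp" "b \<in> Nperp" "b \<noteq> 0" "cinner v a \<noteq> 0"
proof (cases "\<exists>M\<in>\<N>. M \<noteq> UNIV \<and> (\<exists>m\<in>M. cinner m v \<noteq> 0)")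
  case True
  then obtain M m where M: "M \<in> \<N>" "M \<noteq> UNIV" "m \<in> M" "cinner m v \<noteq> 0" by blast
  then have NM: "N \<subseteq> M" using comparable[of M] v cinner_N_Nperp by blast
  obtain Q where Q: "is_projection M Q" by (rule nest_projection[OF M(1)])
  obtain x where x: "x \<notin> M" using M(2) by blast
  let ?b = "x - op_apply Q x" and ?a = "op_apply Q v"
  have Qin: "op_apply Q z \<in> M" and orth: "\<And>m. m \<in> M \<Longrightarrow> cinner (z - op_apply Q z) m = 0" for z
    using Q by (auto simp: is_projection_def)
  have b0: "?b \<noteq> 0" using Qin[of x] x by auto
  have bperp: "?b \<in> Nperp" using orth NM by (auto simp: Nperp_def)
  have aperp: "?a \<in> Nperp"
  proof -
    have "cinner ?a n = 0" if "n \<in> N" for n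
      using orth[of n v] that NM v cinner_N_Nperp(2)[of n v] by (auto simp: cinner_diff_left)
    then show ?thesis by (simp add: Nperp_def)
  qed
  have va: "cinner v ?a = cinner ?a ?a" using orth[OF Qin, of v v] by (simp add: cinner_diff_left)
  have "?a \<noteq> 0"
  proof
    assume "?a = 0"
    then have "cinner v m = 0" using orth[OF M(3), of v] by simp
    then show False using M(4) cinner_eq_zero_commute by blast
  qed
  then have "cinner v ?a \<noteq> 0" using va by (simp add: cinner_eq_zero_iff)
  moreover have "adm ?a ?b"
    unfolding rank_one_admissible_def
  proof
    fix L assume "L \<in> \<N>"
    then consider "M \<subseteq> L" | "L \<subseteq> M" using nest_chain M(1) by blast
    then show "?a \<in> L \<or> (\<forall>m\<in>L. cinner m ?b = 0)"
      using Qin orth cinner_eq_zero_commute by cases blast+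
  qed
  ultimately show ?thesis using that aperp bperp b0 by blast
next
  case False
  then have "adm v v" by (auto simp: rank_one_admissible_def)
  then show ?thesis using that[of v v] v by (simp add: cinner_eq_zero_iff)
qed

lemma N_nonzero: "\<exists>a\<in>N. a \<noteq> 0"
  using nonzero complex_vector.subspace_0[OF subspace_N] by blast

lemma Nperp_nonzero: "\<exists>b\<in>Nperp. b \<noteq> 0"
proof -
  obtain x where "x \<notin> N" using proper by blast
  then have "x - op_apply P x \<noteq> 0" using P_in[of x] by (metis right_minus_eq)
  then show ?thesis using P_compl by blast
qed

text \<open>By \<open>adm_separates_N\<close> the operator \<open>z\<close> kills every admissible
  \<open>g\<close> in \<open>Nperp\<close>. Its kernel is closed and contains \<open>N\<close>, so a
  vector orthogonal to the kernel lies in \<open>Nperp\<close>, where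
  \<open>adm_separates_Nperp\<close> leaves only zero.\<close>

lemma upper_eq_zeroI:
  assumes z: "z \<in> upper (nest_algebra \<N>) P"
    and orth: "\<And>a b g d. adm a b \<Longrightarrow> a \<in> N \<Longrightarrow> a \<noteq> 0 \<Longrightarrow> b \<in> N \<Longrightarrow>
      adm g d \<Longrightarrow> g \<in> Nperp \<Longrightarrow> d \<in> Nperp \<Longrightarrow> d \<noteq> 0 \<Longrightarrow> cinner (op_apply z g) b = 0"
  shows "z = 0"
proof (rule bounded_op_eqI)
  have zg: "op_apply z g = 0" if g: "adm g d" "g \<in> Nperp" "d \<in> Nperp" "d \<noteq> 0" for g d
  proof (rule ccontr)
    assume "op_apply z g \<noteq> 0"
    then obtain a b where "adm a b" "a \<in> N" "a \<noteq> 0" "b \<in> N" "cinner (op_apply z g) b \<noteq> 0"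
      using adm_separates_N[OF upper_apply(1)[OF z]] by blast
    then show False using orth g by blast
  qed
  define K where "K = {v. op_apply z v = 0}"
  have "complex_vector.subspace K" by (auto simp: K_def complex_vector.subspace_def)
  moreover have "closed K"
    unfolding K_def
    by (intro closed_Collect_eq linear_continuous_on op_apply_bounded_linear continuous_on_const)
  ultimately obtain Q where Q: "is_projection K Q" using projection_exists by blast
  fix x
  let ?v = "x - op_apply Q x"
  have orthv: "\<And>k. k \<in> K \<Longrightarrow> cinner ?v k = 0" using Q by (simp add: is_projection_def)
  have "N \<subseteq> K" using upper_apply(2)[OF z] by (auto simp: K_def)
  then have vperp: "?v \<in> Nperp" using orthv by (auto simp: Nperp_def)
  have "?v = 0"
  proof (rule ccontr)
    assume "?v \<noteq> 0"
    then obtain a b where "adm a b" "a \<in> Nperp" "b \<in> Nperp" "b \<noteq> 0" "cinner ?v a \<noteq> 0"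
      using adm_separates_Nperp[OF vperp] by blast
    moreover from this have "a \<in> K" using zg by (simp add: K_def)
    ultimately show False using orthv by blast
  qed
  then have "x = op_apply Q x" by simp
  moreover have "op_apply Q x \<in> K" using Q by (simp add: is_projection_def)
  ultimately show "op_apply z x = op_apply 0 x" by (simp add: K_def)
qed

section \<open>Endomorphisms of the corner and the size of the diagonal\<close>

lemma rank_one_sandwich: "rank_one a b * (y * rank_one g d) = cinner (op_apply y g) b *\<^sub>C rank_one a d"
  by (rule bounded_op_eqI) (simp add: cinner_simps scaleC_scaleC mult.commute)

text \<open>\<open>S\<close> commutes with multiplication by admissible rank-one operators of
  \<open>N\<close> on the left and of \<open>Nperp\<close> on the right. Sandwiching
  \<open>y\<close> between two of them compares multiples of \<open>S (rank_one a d)\<close> and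
  \<open>rank_one a d\<close>, which determines \<open>S\<close> first on such operators and then,
  by separation, on the whole corner.\<close>

lemma endo_upper_scalar:
  assumes closed: "\<And>y. y \<in> upper (nest_algebra \<N>) P \<Longrightarrow> S y \<in> upper (nest_algebra \<N>) P"
    and scale: "\<And>c y. y \<in> upper (nest_algebra \<N>) P \<Longrightarrow> S (c *\<^sub>C y) = c *\<^sub>C S y"
    and equiv: "\<And>b y. b \<in> diag (nest_algebra \<N>) P \<Longrightarrow> y \<in> upper (nest_algebra \<N>) P \<Longrightarrow>
      S (commutator b y) = commutator b (S y)"
  shows "\<exists>c. \<forall>y\<in>upper (nest_algebra \<N>) P. S y = c *\<^sub>C y"
proof -
  let ?U = "upper (nest_algebra \<N>) P"
  have left: "S (rank_one a b * y) = rank_one a b * S y"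
    if "adm a b" "a \<in> N" "b \<in> N" "y \<in> ?U" for a b y
  proof -
    \<comment> \<open>\<open>y\<close> kills \<open>N\<close>, so \<open>[rank_one a b, y]\<close>
      is the plain product.\<close>
    have "y * rank_one a b = 0" if "y \<in> ?U" for y
      using \<open>a \<in> N\<close> that by (auto simp: upper_apply intro!: bounded_op_eqI)
    then show ?thesis
      using equiv[OF rank_one_diag_N[OF that(1-3)] that(4)] closed[OF that(4)] that(4)
      by (simp add: commutator_def)
  qed
  have right: "S (y * rank_one g d) = S y * rank_one g d"
    if "adm g d" "g \<in> Nperp" "d \<in> Nperp" "y \<in> ?U" for g d y
  proof -
    have c: "commutator (rank_one g d) y = (- 1) *\<^sub>C (y * rank_one g d)" if "y \<in> ?U" for y
    proof -
      have "rank_one g d * y = 0"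
        using \<open>d \<in> Nperp\<close> that by (auto simp: upper_apply cinner_N_Nperp intro!: bounded_op_eqI)
      then show ?thesis by (simp add: commutator_def scaleC_one)
    qed
    have "y * rank_one g d \<in> ?U" using rank_one_diag_Nperp[OF that(1-3)] that(4) by simp
    then show ?thesis
      using equiv[OF rank_one_diag_Nperp[OF that(1-3)] that(4)] scale[of "y * rank_one g d" "-1"]
      by (simp add: c that(4) closed scaleC_one)
  qed
  have sandwich: "cinner (op_apply y g) b *\<^sub>C S (rank_one a d) = cinner (op_apply (S y) g) b *\<^sub>C rank_one a d"
    if "adm a b" "a \<in> N" "b \<in> N" "adm g d" "g \<in> Nperp" "d \<in> Nperp" "y \<in> ?U" for a b g d y
  proof -
    have "y * rank_one g d \<in> ?U" using rank_one_diag_Nperp that by simp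
    then have "S (rank_one a b * (y * rank_one g d)) = rank_one a b * (S y * rank_one g d)"
      using that by (simp add: left right)
    moreover have "rank_one a d \<in> ?U" using that by (intro rank_one_upper)
    ultimately show ?thesis by (simp add: rank_one_sandwich scale)
  qed
  \<comment> \<open>This solves the sandwich identity at \<open>y = rank_one b g\<close> for
    \<open>S (rank_one a d)\<close>; the factor on its left is then
    \<open>cinner g g * cinner b b\<close>. The coefficient depends on neither \<open>a\<close> nor
    \<open>d\<close>.\<close>
  define s where "s b g = cinner (op_apply (S (rank_one b g)) g) b / (cinner g g * cinner b b)" for b g
  have S_rank_one: "S (rank_one a d) = s b g *\<^sub>C rank_one a d"
    if h: "adm a b" "a \<in> N" "b \<in> N" "b \<noteq> 0" "adm g d" "g \<in> Nperp" "g \<noteq> 0" "d \<in> Nperp" for a b g d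
  proof -
    let ?n = "cinner g g * cinner b b"
    have n: "?n \<noteq> 0" using h by (simp add: cinner_eq_zero_iff)
    have "?n *\<^sub>C S (rank_one a d) = cinner (op_apply (S (rank_one b g)) g) b *\<^sub>C rank_one a d"
      using sandwich[of a b g d "rank_one b g"] h rank_one_upper[OF h(3,6)] by (simp add: cinner_scaleC_left)
    then have "inverse ?n *\<^sub>C (?n *\<^sub>C S (rank_one a d)) = s b g *\<^sub>C rank_one a d"
      by (simp add: scaleC_scaleC s_def divide_inverse mult.commute)
    moreover have "inverse ?n *\<^sub>C (?n *\<^sub>C S (rank_one a d)) = S (rank_one a d)"
      unfolding scaleC_scaleC left_inverse[OF n] by (rule scaleC_one)
    ultimately show ?thesis by simp
  qed
  have rank_one_nonzero: "rank_one a d \<noteq> 0" if "a \<noteq> 0" "d \<noteq> 0" for a d :: 'a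
  proof
    assume "rank_one a d = 0"
    then have "cinner d d *\<^sub>C a = 0" using op_apply_rank_one[of a d d] by simp
    then show False using that by (simp add: cinner_eq_zero_iff)
  qed
  obtain v where v: "v \<in> N" "v \<noteq> 0" using N_nonzero by blast
  obtain w where w: "w \<in> Nperp" "w \<noteq> 0" using Nperp_nonzero by blast
  obtain a0 b0 where ab: "adm a0 b0" "a0 \<in> N" "a0 \<noteq> 0" "b0 \<in> N" "b0 \<noteq> 0"
    using adm_separates_N[OF v] by (metis cinner_zero_right)
  obtain g0 d0 where gd: "adm g0 d0" "g0 \<in> Nperp" "d0 \<in> Nperp" "d0 \<noteq> 0" "g0 \<noteq> 0"
    using adm_separates_Nperp[OF w] by (metis cinner_zero_right)
  have const: "S (rank_one a d) = s b0 g0 *\<^sub>C rank_one a d"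
    if h: "adm a b" "a \<in> N" "a \<noteq> 0" "b \<in> N" "b \<noteq> 0" "adm g d" "g \<in> Nperp" "g \<noteq> 0" "d \<in> Nperp" "d \<noteq> 0"
    for a b g d
  proof -
    have cmp: "s b g = s b' g'" if "S (rank_one a' d') = s b g *\<^sub>C rank_one a' d'"
      "S (rank_one a' d') = s b' g' *\<^sub>C rank_one a' d'" "a' \<noteq> 0" "d' \<noteq> 0" for b g b' g' a' d'
      using that rank_one_nonzero[OF that(3,4)] by simp
    \<comment> \<open>Depending on which exchanged pair is admissible, \<open>rank_one a d\<close>
      or \<open>rank_one a0 d\<close> carries both coefficients, which must then agree.\<close>
    have "s b g = s b0 g"
      using rank_one_admissible_exchange[OF nest_chain h(1) ab(1)]
        cmp[of a d b g b0 g] cmp[of a0 d b g b0 g] S_rank_one h ab by metis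
    also have "s b0 g = s b0 g0"
      using rank_one_admissible_exchange[OF nest_chain h(6) gd(1)]
        cmp[of a0 d b0 g b0 g0] cmp[of a0 d0 b0 g b0 g0] S_rank_one h ab gd by metis
    finally show ?thesis using S_rank_one h by metis
  qed
  have "S y = s b0 g0 *\<^sub>C y" if y: "y \<in> ?U" for y
  proof -
    have "S y - s b0 g0 *\<^sub>C y = 0"
    proof (rule upper_eq_zeroI)
      show "S y - s b0 g0 *\<^sub>C y \<in> ?U" using y closed by simp
      fix a b g d
      assume h: "adm a b" "a \<in> N" "a \<noteq> 0" "b \<in> N" "adm g d" "g \<in> Nperp" "d \<in> Nperp" "d \<noteq> 0"
      show "cinner (op_apply (S y - s b0 g0 *\<^sub>C y) g) b = 0"
      proof (cases "b = 0 \<or> g = 0")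
        case False
        \<comment> \<open>The sandwich identity is now read backwards: with
          \<open>S (rank_one a d)\<close> known, it yields the matrix entries of
          \<open>S y\<close>.\<close>
        have "cinner (op_apply y g) b *\<^sub>C S (rank_one a d) = cinner (op_apply (S y) g) b *\<^sub>C rank_one a d"
          using sandwich h y by blast
        moreover have "S (rank_one a d) = s b0 g0 *\<^sub>C rank_one a d"
          using const[OF h(1-4) _ h(5,6) _ h(7,8)] False by blast
        ultimately have "(cinner (op_apply y g) b * s b0 g0) *\<^sub>C rank_one a d
            = cinner (op_apply (S y) g) b *\<^sub>C rank_one a d"
          by (simp add: scaleC_scaleC)
        then have "cinner (op_apply (S y) g) b = cinner (op_apply y g) b * s b0 g0"
          using rank_one_nonzero[OF h(3,8)] by simp
        then show ?thesis by (simp add: cinner_simps)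
      qed auto
    qed
    then show ?thesis by simp
  qed
  then show ?thesis by blast
qed

text \<open>Otherwise a rank-one operator on \<open>N\<close> would act there as a nonzero scalar,
  so \<open>N\<close> would be a line, and likewise \<open>Nperp\<close>. By \<open>dim3\<close>
  some nonzero vector is orthogonal to both lines, which is absurd.\<close>

lemma diag_not_spanned: "\<exists>b\<in>diag (nest_algebra \<N>) P. \<forall>c d. b \<noteq> c *\<^sub>C P + d *\<^sub>C id_op"
proof (rule ccontr)
  assume neg: "\<not> ?thesis"
  obtain v where v: "v \<in> N" "v \<noteq> 0" using N_nonzero by blast
  obtain w where w: "w \<in> Nperp" "w \<noteq> 0" using Nperp_nonzero by blast
  obtain a b where ab: "adm a b" "a \<in> N" "a \<noteq> 0" "b \<in> N" "b \<noteq> 0"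
    using adm_separates_N[OF v] by (metis cinner_zero_right)
  obtain g h where gh: "adm g h" "g \<in> Nperp" "h \<in> Nperp" "h \<noteq> 0" "g \<noteq> 0"
    using adm_separates_Nperp[OF w] by (metis cinner_zero_right)
  obtain c d where cd: "rank_one a b = c *\<^sub>C P + d *\<^sub>C id_op"
    using neg rank_one_diag_N[OF ab(1,2,4)] by blast
  obtain c' d' where cd': "rank_one g h = c' *\<^sub>C P + d' *\<^sub>C id_op"
    using neg rank_one_diag_Nperp[OF gh(1-3)] by blast
  have N_line: "cinner x b *\<^sub>C a = (c + d) *\<^sub>C x" if "x \<in> N" for x
    using arg_cong[OF cd, of "\<lambda>T. op_apply T x"] that by (simp add: scaleC_add_left)
  have Nperp_line: "cinner x h *\<^sub>C g = d' *\<^sub>C x" if "x \<in> Nperp" for x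
    using arg_cong[OF cd', of "\<lambda>T. op_apply T x"] that by simp
  have cd0: "c + d \<noteq> 0" using N_line[OF ab(4)] ab by (auto simp: cinner_eq_zero_iff)
  then have cd0': "cnj (c + d) \<noteq> 0" by (metis complex_cnj_zero_iff)
  have d0: "d' \<noteq> 0" using Nperp_line[OF gh(3)] gh by (auto simp: cinner_eq_zero_iff)
  obtain u where u: "u \<noteq> 0" "cinner u a = 0" "cinner u g = 0" using dim3 by blast
  let ?x = "op_apply P u" and ?y = "u - op_apply P u"
  have "cinner ?x a = 0" using u ab by (simp add: P_cinner)
  then have "cinner ?x ((c + d) *\<^sub>C ?x) = 0" using N_line[OF P_in, of u] by (metis cinner_scaleC_right mult_zero_right)
  then have x0: "?x = 0" using cd0' by (simp add: cinner_scaleC_right cinner_eq_zero_iff del: complex_cnj_add)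
  have "cinner ?y g = 0" using u x0 by simp
  then have "cinner ?y (d' *\<^sub>C ?y) = 0" using Nperp_line[OF P_compl, of u] by (metis cinner_scaleC_right mult_zero_right)
  then have "?y = 0" using d0 by (simp add: cinner_scaleC_right cinner_eq_zero_iff)
  then show False using x0 u(1) by simp
qed

sublocale peirce_scalar "nest_algebra \<N>" id_op P
proof
  show "d * P = 0" if d: "\<And>y. y \<in> upper (nest_algebra \<N>) P \<Longrightarrow> d * y = 0" for d
  proof (rule bounded_op_eqI)
    fix x
    obtain b where b: "b \<in> Nperp" "b \<noteq> 0" using Nperp_nonzero by blast
    \<comment> \<open>The corner contains an operator sending \<open>b\<close> to a nonzero multiple
      of \<open>P x\<close>, so \<open>d\<close> must kill \<open>P x\<close>.\<close>
    have "op_apply (d * rank_one (op_apply P x) b) b = 0"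
      using d[OF rank_one_upper[OF P_in b(1)]] by simp
    then show "op_apply (d * P) x = op_apply 0 x"
      using b(2) by (simp add: cinner_eq_zero_iff)
  qed
  show "P * d = d" if d: "\<And>y. y \<in> upper (nest_algebra \<N>) P \<Longrightarrow> y * d = 0" for d
  proof (rule bounded_op_eqI)
    fix x
    let ?b = "op_apply d x - op_apply P (op_apply d x)"
    obtain a where a: "a \<in> N" "a \<noteq> 0" using N_nonzero by blast
    have "op_apply (rank_one a ?b * d) x = 0"
      using d[OF rank_one_upper[OF a(1) P_compl]] by simp
    then have "cinner (op_apply d x) ?b = 0" using a(2) by simp
    moreover have "cinner (op_apply P (op_apply d x)) ?b = 0" by (rule cinner_N_Nperp(1)[OF P_in P_compl])
    ultimately have "cinner ?b ?b = 0" by (simp add: cinner_diff_left)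
    then show "op_apply (P * d) x = op_apply d x" by (simp add: cinner_eq_zero_iff)
  qed
qed (use endo_upper_scalar diag_not_spanned in auto)

end

section \<open>The trivial and the nontrivial nest\<close>

lemma scalar_in_center:
  assumes "id_op \<in> nest_algebra \<N>" "\<And>x c. x \<in> nest_algebra \<N> \<Longrightarrow> c *\<^sub>C x \<in> nest_algebra \<N>"
    and "x \<in> complex_vector.span {id_op}"
  shows "x \<in> center (nest_algebra \<N>)"
proof -
  have "id_op * y = y" "y * id_op = y" for y :: "'a bounded_op"
    by (auto intro!: bounded_op_eqI)
  then show ?thesis
    using assms by (auto simp: complex_vector.span_singleton center_def mult_scaleC_left mult_scaleC_right)
qed

text \<open>For nonzero \<open>v\<close> orthogonal to \<open>\<xi>\<close>, a third direction
  \<open>w\<close> gives \<open>h = [rank_one v w, rank_one w v]\<close>, which kills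
  \<open>\<xi>\<close> and has \<open>v\<close> as eigenvector with nonzero eigenvalue. Since
  \<open>k\<close> commutes with \<open>h\<close>, it cannot link \<open>v\<close> and
  \<open>\<xi>\<close> in either direction.\<close>

lemma off_diagonal_zero:
  fixes \<xi> :: "'a::complex_hilbert_space"
  assumes dim3: "\<And>u v :: 'a. \<exists>w. w \<noteq> 0 \<and> cinner w u = 0 \<and> cinner w v = 0"
    and \<xi>: "\<xi> \<noteq> 0"
    and k: "cinner (op_apply k \<xi>) \<xi> = 0" "\<And>v. cinner v \<xi> = 0 \<Longrightarrow> \<exists>c. op_apply k v = c *\<^sub>C \<xi>"
    and comm: "\<And>u v. cinner u \<xi> = 0 \<Longrightarrow> cinner v \<xi> = 0 \<Longrightarrow>
      commutator (commutator (rank_one u v) (rank_one v u)) k = 0"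
  shows "k = 0"
proof -
  have h: "op_apply k v = 0 \<and> (op_apply k \<xi> = v \<longrightarrow> v = 0)" if v: "cinner v \<xi> = 0" for v
  proof (cases "v = 0")
    case False
    obtain w where w: "w \<noteq> 0" "cinner w \<xi> = 0" "cinner w v = 0" using dim3 by blast
    let ?h = "commutator (rank_one v w) (rank_one w v)"
    have hk: "op_apply ?h (op_apply k x) = op_apply k (op_apply ?h x)" for x
      using arg_cong[OF comm[OF v w(2)], of "\<lambda>T. op_apply T x"] by (simp add: commutator_def)
    have zero: "cinner v w = 0" "cinner \<xi> v = 0" "cinner \<xi> w = 0"
      using w v cinner_eq_zero_commute by blast+
    have hv: "op_apply ?h v = (cinner v v * cinner w w) *\<^sub>C v"
      by (simp add: commutator_def cinner_simps zero scaleC_scaleC mult.commute)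
    have h\<xi>: "op_apply ?h \<xi> = 0"
      by (simp add: commutator_def cinner_simps zero)
    have n: "cinner v v * cinner w w \<noteq> 0" using False w by (simp add: cinner_eq_zero_iff)
    obtain c where "op_apply k v = c *\<^sub>C \<xi>" using k(2)[OF v] by blast
    then have "(cinner v v * cinner w w) *\<^sub>C op_apply k v = 0"
      using hk[of v] by (simp add: hv h\<xi>)
    then have "op_apply k v = 0" using n by simp
    moreover have "v = 0" if "op_apply k \<xi> = v"
      using hk[of \<xi>] n unfolding h\<xi> that hv by simp
    ultimately show ?thesis by blast
  qed simp
  have k\<xi>: "op_apply k \<xi> = 0" using h k(1) by blast
  show ?thesis
  proof (rule bounded_op_eqI)
    fix x
    let ?t = "cinner x \<xi> / cinner \<xi> \<xi>"
    have "cinner (x - ?t *\<^sub>C \<xi>) \<xi> = 0" using \<xi> by (simp add: cinner_simps cinner_eq_zero_iff)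
    then have "op_apply k (x - ?t *\<^sub>C \<xi>) = 0" using h by blast
    then show "op_apply k x = op_apply 0 x" by (simp add: k\<xi>)
  qed
qed

theorem corollary3p9:
  fixes \<N> :: "'a::complex_hilbert_space set set"
    and \<phi> :: "'a bounded_op \<Rightarrow> 'a bounded_op \<Rightarrow> 'a bounded_op"
  assumes "complex_dim_ge TYPE('a) 3"
    and "nest \<N>"
    and "Lie_biderivation (nest_algebra \<N>) \<phi>"
  shows "\<exists>a\<in>nest_algebra \<N>. \<exists>l\<in>center (nest_algebra \<N>).
           \<exists>\<mu> :: 'a bounded_op \<Rightarrow> 'a bounded_op \<Rightarrow> 'a bounded_op.
             (\<forall>x\<in>nest_algebra \<N>. \<forall>y\<in>nest_algebra \<N>. \<mu> x y \<in> center (nest_algebra \<N>)) \<and>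
             (\<forall>x\<in>nest_algebra \<N>. \<forall>y\<in>nest_algebra \<N>.
                \<phi> x y = commutator x (commutator y a) + l * commutator x y + \<mu> x y)"
proof -
  let ?A = "nest_algebra \<N>"
  note dim3 = complex_dim_ge_3_orthogonal[OF assms(1)]
  have nest: "\<forall>M\<in>\<N>. complex_vector.subspace M \<and> closed M" "{0} \<in> \<N>" "UNIV \<in> \<N>"
      "\<forall>M\<in>\<N>. \<forall>N\<in>\<N>. M \<subseteq> N \<or> N \<subseteq> M"
    using assms(2) by (auto simp: nest_def)
  have main: "\<exists>a\<in>?A. \<exists>l. \<forall>x\<in>?A. \<forall>y\<in>?A.
      \<phi> x y - commutator x (commutator y a) - l *\<^sub>C commutator x y \<in> complex_vector.span {id_op}"
  proof (cases "\<exists>N\<in>\<N>. N \<noteq> {0} \<and> N \<noteq> UNIV")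
    case True
    then obtain N where N: "N \<in> \<N>" "N \<noteq> {0}" "N \<noteq> UNIV" by blast
    then obtain P where P: "is_projection N P" using projection_exists nest(1) by blast
    interpret comparable_subspace \<N> N P
      by unfold_locales (use N P assms(2) nest(4) dim3 in auto)
    \<comment> \<open>\<open>N\<close> is in the nest, so \<open>x = x P\<close> has its range in
      \<open>N\<close>, where \<open>P\<close> is the identity; but \<open>P x = 0\<close>.\<close>
    have "x = 0" if x: "x \<in> upper ?A (id_op - P)" for x
    proof (rule bounded_op_eqI)
      fix v
      have xA: "x \<in> ?A" and Px: "P * x = 0" "x * P = x" using x by (auto simp: upper_complement)
      have "op_apply x v = op_apply x (op_apply P v)" by (metis Px(2) op_apply_simps(3))
      also have "\<dots> \<in> N" using nest_algebra_apply[OF xA N(1) P_in] .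
      finally have "op_apply x v = op_apply P (op_apply x v)" by simp
      also have "\<dots> = op_apply (P * x) v" by simp
      finally show "op_apply x v = op_apply 0 v" by (simp only: Px(1))
    qed
    then have "upper ?A (id_op - P) = {0}" by (auto simp: upper_def)
    then show ?thesis by (rule Lie_biderivation_triangular[OF assms(3)])
  next
    case False
    \<comment> \<open>Only \<open>{0}\<close> and \<open>UNIV\<close> are in the nest, and every
      operator leaves both invariant.\<close>
    have full: "T \<in> ?A" for T :: "'a bounded_op"
      using False unfolding nest_algebra_def by force
    obtain \<xi> :: 'a where \<xi>: "\<xi> \<noteq> 0" using dim3 by blast
    define N where "N = range (\<lambda>c. c *\<^sub>C \<xi>)"
    define P where "P = (1 / cinner \<xi> \<xi>) *\<^sub>C rank_one \<xi> \<xi>"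
    have n: "cinner \<xi> \<xi> \<noteq> 0" using \<xi> by (simp add: cinner_eq_zero_iff)
    have P: "is_projection N P"
      unfolding is_projection_def
    proof (intro conjI allI ballI)
      show "complex_vector.subspace N"
        unfolding N_def complex_vector.span_singleton[symmetric] by (rule complex_vector.subspace_span)
      fix x
      have Px: "op_apply P x = (cinner x \<xi> / cinner \<xi> \<xi>) *\<^sub>C \<xi>" by (simp add: P_def scaleC_scaleC)
      then show "op_apply P x \<in> N" by (auto simp: N_def)
      show "cinner (x - op_apply P x) m = 0" if "m \<in> N" for m
        using that n by (auto simp: N_def Px cinner_simps)
    qed
    have \<xi>N: "\<xi> \<in> N" unfolding N_def using scaleC_one[of \<xi>] by (metis rangeI)
    have notall: "N \<noteq> UNIV"
    proof
      assume "N = UNIV"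
      obtain w where w: "w \<noteq> 0" "cinner w \<xi> = 0" using dim3 by blast
      then obtain c where "w = c *\<^sub>C \<xi>" using \<open>N = UNIV\<close> unfolding N_def by blast
      then show False using w n by (auto simp: cinner_simps)
    qed
    have comp: "M \<subseteq> K \<or> K \<subseteq> M" if "M \<in> \<N>" "complex_vector.subspace K" for M K
    proof -
      have "M = {0} \<or> M = UNIV" using False that(1) by blast
      then show ?thesis using complex_vector.subspace_0[OF that(2)] by auto
    qed
    have sub: "complex_vector.subspace N" using P by (simp add: is_projection_def)
    interpret comparable_subspace \<N> N P
    proof
      show "N \<noteq> {0}" using \<xi> \<xi>N by blast
    qed (fact comp[OF _ sub] assms(2) P notall dim3)+
    have Nperp_iff: "v \<in> Nperp \<longleftrightarrow> cinner v \<xi> = 0" for v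
    proof
      show "cinner v \<xi> = 0" if "v \<in> Nperp" using that \<xi>N by (rule cinner_N_Nperp(2)[rotated])
      assume v: "cinner v \<xi> = 0"
      have "cinner v m = 0" if m: "m \<in> N" for m
      proof -
        obtain c where "m = c *\<^sub>C \<xi>" using m unfolding N_def by blast
        then show ?thesis using v by (simp only: cinner_scaleC_right mult_zero_right)
      qed
      then show "v \<in> Nperp" unfolding Nperp_def by blast
    qed
    \<comment> \<open>The same locale at the orthogonal complement makes the opposite corner scalar
      as well.\<close>
    interpret q: comparable_subspace \<N> Nperp "id_op - P"
    proof
      show "is_projection Nperp (id_op - P)"
        using is_projection_complement[OF P] by (simp add: Nperp_def)
      show "Nperp \<noteq> {0}" using Nperp_nonzero by blast
      show "Nperp \<noteq> UNIV" using Nperp_iff n by blast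
    qed (fact comp[OF _ subspace_Nperp] assms(2) dim3)+
    have off: "m + k = 0"
      if m: "m \<in> upper ?A P" and k: "k \<in> upper ?A (id_op - P)"
        and comm: "\<And>b b'. b \<in> diag ?A P \<Longrightarrow> b' \<in> diag ?A P \<Longrightarrow> commutator (commutator b b') (m + k) = 0"
      for m k
    proof (rule off_diagonal_zero[OF dim3 \<xi>])
      have "op_apply (m + k) \<xi> \<in> Nperp" using upper_apply(2)[OF m \<xi>N] q.upper_apply(1)[OF k] by simp
      then show "cinner (op_apply (m + k) \<xi>) \<xi> = 0" by (simp add: Nperp_iff)
      show "\<exists>c. op_apply (m + k) v = c *\<^sub>C \<xi>" if "cinner v \<xi> = 0" for v
      proof -
        have "op_apply m v \<in> N" "op_apply k v = 0"
          using upper_apply(1)[OF m] q.upper_apply(2)[OF k] that by (simp_all only: Nperp_iff)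
        then have "op_apply (m + k) v \<in> N" by simp
        then show ?thesis unfolding N_def by blast
      qed
      show "commutator (commutator (rank_one u v) (rank_one v u)) (m + k) = 0"
        if "cinner u \<xi> = 0" "cinner v \<xi> = 0" for u v
        using that full by (intro comm)
          (auto simp: diag_def P_cinner Nperp_iff intro!: bounded_op_eqI)
    qed
    have "\<exists>l. \<forall>x\<in>?A. \<forall>y\<in>?A. \<phi> x y - l *\<^sub>C commutator x y \<in> complex_vector.span {id_op}"
      by (rule Lie_biderivation_two_sided[OF assms(3) q.peirce_scalar_axioms off])
    then show ?thesis using full by (intro bexI[of _ 0]) auto
  qed
  then obtain a l where al: "a \<in> ?A" "\<And>x y. x \<in> ?A \<Longrightarrow> y \<in> ?A \<Longrightarrow>
      \<phi> x y - commutator x (commutator y a) - l *\<^sub>C commutator x y \<in> complex_vector.span {id_op}"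
    by blast
  have center: "x \<in> center ?A" if "x \<in> complex_vector.span {id_op}" for x
    using that nest(1)
    by (intro scalar_in_center) (auto simp: nest_algebra_def image_subset_iff complex_vector.subspace_scale)
  have unit: "id_op * y = y" for y :: "'a bounded_op" by (rule bounded_op_eqI) simp
  \<comment> \<open>The central mapping is the remainder, whose values are scalars; the central
    factor is \<open>l\<close> times the identity.\<close>
  let ?\<mu> = "\<lambda>x y. \<phi> x y - commutator x (commutator y a) - l *\<^sub>C commutator x y"
  have "l *\<^sub>C id_op \<in> center ?A"
    by (intro center complex_vector.span_scale complex_vector.span_base) simp
  moreover have "\<forall>x\<in>?A. \<forall>y\<in>?A. ?\<mu> x y \<in> center ?A"
    using al(2) by (blast intro: center)
  moreover have "\<forall>x\<in>?A. \<forall>y\<in>?A.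
      \<phi> x y = commutator x (commutator y a) + (l *\<^sub>C id_op) * commutator x y + ?\<mu> x y"
    by (simp add: mult_scaleC_left unit)
  ultimately show ?thesis
    using al(1) by (intro bexI[of _ a] bexI[of _ "l *\<^sub>C id_op"] exI[of _ ?\<mu>] conjI)
qed

end
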